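(* (a) Let $Y$ be a Banach space and suppose a net $(C_\alpha)$ of closed convex subsets of $Y$ converges slice (respectively, Mosco) to a closed convex set $C$ in $Y$. If $X$ is a superspace of $Y$, then $C_\alpha$ converges slice (respectively, Mosco) to $C$ in $X$. (b) Wijsman convergence in $X$ is not necessarily preserved in $X\times\mathbb{R}$: there exist a Banach space $X$, a Banach space norm on $X\times\mathbb{R}$ (equivalent to the product norms) whose restriction to $X\times\{0\}\cong X$ is the norm of $X$, a net $(C_\alpha)$ of closed convex subsets of $X$ and a closed convex set $C\subset X$ such that $C_\alpha$ converges Wijsman to $C$ in $X$ but $C_\alpha\times\{0\}$ does not converge Wijsman to $C\times\{0\}$ in $X\times\mathbb{R}$.
   Context: Banach spaces are real. A superspace of a Banach space $Y$ is a Banach space containing $Y$ as a closed linear subspace with the relative norm. $d(x,A)=\inf\{\|x-a\|:a\in A\}$ and $d(A,B)=\inf\{\|a-b\|:a\in A,b\in B\}$, with value $\infty$ if a set involved is empty. For closed convex subsets $C_\alpha$ (a net), $C$ of a Banach space $Z$: - $C_\alpha$ converges Wijsman to $C$ in $Z$ if $\lim_\alpha d(z,C_\alpha)=d(z,C)$ for all $z\in Z$; - $C_\alpha$ converges slice to $C$ in $Z$ if $\lim_\alpha d(W,C_\alpha)=d(W,C)$ for all closed bounded convex $W\subset Z$; - $C_\alpha$ converges Mosco to $C$ in $Z$ if (M(i)) $d(z,C_\alpha)\to0$ for every $z\in C$, and (M(ii)) whenever $z_{\alpha_\beta}\in C_{\alpha_\beta}$ for some subnet, $\{z_{\alpha_\beta}\}_\beta$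 is relatively weakly compact and $z_{\alpha_\beta}\to z$ weakly, then $z\in C$. *)

theory Defs
  imports "HOL-Analysis.Analysis"
begin

section \<open>Real Banach spaces as carrier sets with an explicit norm\<close>

text \<open>
  Subspaces, superspaces and several norms on one vector space occur side by side, so a Banach
  space is a pair of a linear subspace \<open>V\<close> of some real vector space and a function \<open>N\<close> whose
  values on \<open>V\<close> form a complete norm.  Values of \<open>N\<close> outside \<open>V\<close> are irrelevant; \<open>ndist\<close> is
  cut off outside \<open>V\<close> because the library locale for metric spaces wants a distance that is
  nonnegative and symmetric on the whole type.
\<close>

definition norm_on :: "'v::real_vector set \<Rightarrow> ('v \<Rightarrow> real) \<Rightarrow> bool" where
  "norm_on V N \<longleftrightarrow> subspace V \<and>
     (\<forall>x\<in>V. N x = 0 \<longleftrightarrow> x = 0) \<and>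
     (\<forall>x\<in>V. \<forall>y\<in>V. N (x + y) \<le> N x + N y) \<and>
     (\<forall>c. \<forall>x\<in>V. N (c *\<^sub>R x) = \<bar>c\<bar> * N x)"

definition ndist :: "'v::real_vector set \<Rightarrow> ('v \<Rightarrow> real) \<Rightarrow> 'v \<Rightarrow> 'v \<Rightarrow> real" where
  "ndist V N x y = (if x \<in> V \<and> y \<in> V then N (x - y) else 0)"

definition banach_on :: "'v::real_vector set \<Rightarrow> ('v \<Rightarrow> real) \<Rightarrow> bool" where
  "banach_on V N \<longleftrightarrow> norm_on V N \<and> Metric_space.mcomplete V (ndist V N)"

definition norm_topology :: "'v::real_vector set \<Rightarrow> ('v \<Rightarrow> real) \<Rightarrow> 'v topology" where
  "norm_topology V N = Metric_space.mtopology V (ndist V N)"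

lemma norm_on_nonneg:
  assumes "norm_on V N" "x \<in> V"
  shows "N x \<ge> 0"
proof -
  have V: "subspace V"
    and tri: "\<And>x y. x \<in> V \<Longrightarrow> y \<in> V \<Longrightarrow> N (x + y) \<le> N x + N y"
    and hom: "\<And>c x. x \<in> V \<Longrightarrow> N (c *\<^sub>R x) = \<bar>c\<bar> * N x"
    using assms(1) unfolding norm_on_def by auto
  have "-x \<in> V" using V assms(2) by (rule subspace_neg)
  then have "N (x + -x) \<le> N x + N (-x)" using tri assms(2) by blast
  moreover have "N (x + -x) = 0" using hom[OF assms(2), of 0] by simp
  moreover have "N (-x) = N x" using hom[OF assms(2), of "-1"] by simp
  ultimately show ?thesis by simp
qed

lemma Metric_space_ndist:
  assumes "norm_on V N"
  shows "Metric_space V (ndist V N)"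
proof
  have V: "subspace V"
    and zero: "\<And>x. x \<in> V \<Longrightarrow> N x = 0 \<longleftrightarrow> x = 0"
    and tri: "\<And>x y. x \<in> V \<Longrightarrow> y \<in> V \<Longrightarrow> N (x + y) \<le> N x + N y"
    and hom: "\<And>c x. x \<in> V \<Longrightarrow> N (c *\<^sub>R x) = \<bar>c\<bar> * N x"
    using assms unfolding norm_on_def by auto
  have sub: "x - y \<in> V" if "x \<in> V" "y \<in> V" for x y
    using V that by (rule subspace_diff)
  fix x y z
  show "0 \<le> ndist V N x y"
    using norm_on_nonneg[OF assms sub] by (simp add: ndist_def)
  show "ndist V N x y = ndist V N y x"
    using hom[OF sub, of x y "-1"] by (auto simp: ndist_def)
  show "ndist V N x y = 0 \<longleftrightarrow> x = y" if "x \<in> V" "y \<in> V"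
    using zero[OF sub[OF that]] that by (simp add: ndist_def)
  show "ndist V N x z \<le> ndist V N x y + ndist V N y z" if "x \<in> V" "y \<in> V" "z \<in> V"
    using tri[OF sub sub, of x y y z] that by (simp add: ndist_def)
qed

lemma banach_on_UNIV: "banach_on (UNIV :: 'a::banach set) norm"
proof -
  have "ndist UNIV norm = (dist :: 'a \<Rightarrow> 'a \<Rightarrow> real)"
    by (simp add: fun_eq_iff ndist_def dist_norm)
  moreover have "Met_TC.mcomplete TYPE('a)"
    using complete_UNIV by (simp add: mcomplete_iff_complete)
  ultimately show ?thesis
    by (simp add: banach_on_def norm_on_def norm_triangle_ineq)
qed

definition superspace ::
  "'v::real_vector set \<Rightarrow> ('v \<Rightarrow> real) \<Rightarrow> 'v set \<Rightarrow> ('v \<Rightarrow> real) \<Rightarrow> bool" where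
  "superspace X NX Y NY \<longleftrightarrow> banach_on X NX \<and> subspace Y \<and> Y \<subseteq> X \<and>
     closedin (norm_topology X NX) Y \<and> (\<forall>y\<in>Y. NY y = NX y)"

definition closed_convex_in :: "'v::real_vector set \<Rightarrow> ('v \<Rightarrow> real) \<Rightarrow> 'v set \<Rightarrow> bool" where
  "closed_convex_in V N A \<longleftrightarrow> closedin (norm_topology V N) A \<and> convex A"

definition equivalent_norms ::
  "'v::real_vector set \<Rightarrow> ('v \<Rightarrow> real) \<Rightarrow> ('v \<Rightarrow> real) \<Rightarrow> bool" where
  "equivalent_norms V N M \<longleftrightarrow>
     (\<exists>a>0. \<exists>b>0. \<forall>x\<in>V. a * N x \<le> M x \<and> M x \<le> b * N x)"

text \<open>The \<open>\<ell>\<^sub>1\<close>-sum; all the usual product norms are equivalent to it.\<close>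

definition product_norm :: "('v \<Rightarrow> real) \<Rightarrow> 'v \<times> real \<Rightarrow> real" where
  "product_norm N = (\<lambda>(x, t). N x + \<bar>t\<bar>)"


section \<open>The weak topology\<close>

definition dual_on :: "'v::real_vector set \<Rightarrow> ('v \<Rightarrow> real) \<Rightarrow> ('v \<Rightarrow> real) set" where
  "dual_on V N = {f.
     (\<forall>x\<in>V. \<forall>y\<in>V. f (x + y) = f x + f y) \<and>
     (\<forall>c. \<forall>x\<in>V. f (c *\<^sub>R x) = c * f x) \<and>
     (\<exists>K. \<forall>x\<in>V. \<bar>f x\<bar> \<le> K * N x)}"

definition weak_topology :: "'v::real_vector set \<Rightarrow> ('v \<Rightarrow> real) \<Rightarrow> 'v topology" where
  "weak_topology V N =
     topology_generated_by {{x \<in> V. f x \<in> U} | f U. f \<in> dual_on V N \<and> open U}"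

lemma topspace_weak_topology: "topspace (weak_topology V N) = V"
proof -
  have "(\<lambda>_. 0) \<in> dual_on V N"
    by (auto simp: dual_on_def intro: exI[of _ 0])
  then have "{x \<in> V. (0::real) \<in> UNIV} \<in> {{x \<in> V. f x \<in> U} | f U. f \<in> dual_on V N \<and> open U}"
    by (intro CollectI exI[of _ "\<lambda>_. 0"] exI[of _ UNIV]) auto
  then show ?thesis
    unfolding weak_topology_def topology_generated_by_topspace by auto
qed

definition relatively_weakly_compact ::
  "'v::real_vector set \<Rightarrow> ('v \<Rightarrow> real) \<Rightarrow> 'v set \<Rightarrow> bool" where
  "relatively_weakly_compact V N S \<longleftrightarrow> S \<subseteq> V \<and>
     compactin (weak_topology V N) (weak_topology V N closure_of S)"


section \<open>Nets\<close>

definition directed_set :: "'i set \<Rightarrow> ('i \<Rightarrow> 'i \<Rightarrow> bool) \<Rightarrow> bool" where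
  "directed_set D le \<longleftrightarrow> D \<noteq> {} \<and>
     (\<forall>a\<in>D. le a a) \<and>
     (\<forall>a\<in>D. \<forall>b\<in>D. \<forall>c\<in>D. le a b \<longrightarrow> le b c \<longrightarrow> le a c) \<and>
     (\<forall>a\<in>D. \<forall>b\<in>D. \<exists>c\<in>D. le a c \<and> le b c)"

definition net_filter :: "'i set \<Rightarrow> ('i \<Rightarrow> 'i \<Rightarrow> bool) \<Rightarrow> 'i filter" where
  "net_filter D le = (INF a\<in>D. principal {b\<in>D. le a b})"

lemma eventually_net_filter:
  assumes "directed_set D le"
  shows "eventually P (net_filter D le) \<longleftrightarrow> (\<exists>a\<in>D. \<forall>b\<in>D. le a b \<longrightarrow> P b)"
proof -
  have ne: "D \<noteq> {}"
    and trans: "\<And>a b c. a \<in> D \<Longrightarrow> b \<in> D \<Longrightarrow> c \<in> D \<Longrightarrow> le a b \<Longrightarrow> le b c \<Longrightarrow> le a c"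
    and dir: "\<And>a b. a \<in> D \<Longrightarrow> b \<in> D \<Longrightarrow> \<exists>c\<in>D. le a c \<and> le b c"
    using assms unfolding directed_set_def by (blast, blast, blast)
  have "eventually P (net_filter D le) \<longleftrightarrow>
        (\<exists>a\<in>D. eventually P (principal {b\<in>D. le a b}))"
    unfolding net_filter_def
  proof (rule eventually_INF_base[OF ne])
    fix a b assume ab: "a \<in> D" "b \<in> D"
    then obtain c where "c \<in> D" "le a c" "le b c" using dir by blast
    moreover from this have "{x\<in>D. le c x} \<subseteq> {x\<in>D. le a x} \<inter> {x\<in>D. le b x}"
      using ab trans[of a c] trans[of b c] by blast
    ultimately show "\<exists>x\<in>D. principal {b \<in> D. le x b} \<le>
        inf (principal {b \<in> D. le a b}) (principal {ba \<in> D. le b ba})"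
      by (intro bexI[of _ c]) (simp_all only: inf_principal principal_le_iff)
  qed
  then show ?thesis by (auto simp: eventually_principal)
qed

text \<open>Subnets in the sense of Kelley: the index map need not be monotone or injective.\<close>

definition subnet ::
  "'i set \<Rightarrow> ('i \<Rightarrow> 'i \<Rightarrow> bool) \<Rightarrow> 'j set \<Rightarrow> ('j \<Rightarrow> 'j \<Rightarrow> bool) \<Rightarrow> ('j \<Rightarrow> 'i) \<Rightarrow> bool" where
  "subnet D le B leB \<phi> \<longleftrightarrow> directed_set B leB \<and> \<phi> ` B \<subseteq> D \<and>
     (\<forall>a\<in>D. \<exists>b\<in>B. \<forall>b'\<in>B. leB b b' \<longrightarrow> le a (\<phi> b'))"


section \<open>Wijsman, slice and Mosco convergence\<close>

text \<open>Distances are extended reals, so that the infimum over the empty set is \<open>\<infinity>\<close>.\<close>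

definition dist_pt :: "('v::real_vector \<Rightarrow> real) \<Rightarrow> 'v \<Rightarrow> 'v set \<Rightarrow> ereal" where
  "dist_pt N x A = (INF a\<in>A. ereal (N (x - a)))"

definition dist_sets :: "('v::real_vector \<Rightarrow> real) \<Rightarrow> 'v set \<Rightarrow> 'v set \<Rightarrow> ereal" where
  "dist_sets N A B = (INF a\<in>A. INF b\<in>B. ereal (N (a - b)))"

definition wijsman_converges :: "'v::real_vector set \<Rightarrow> ('v \<Rightarrow> real) \<Rightarrow>
    'i set \<Rightarrow> ('i \<Rightarrow> 'i \<Rightarrow> bool) \<Rightarrow> ('i \<Rightarrow> 'v set) \<Rightarrow> 'v set \<Rightarrow> bool" where
  "wijsman_converges V N D le Cn C \<longleftrightarrow>
     (\<forall>z\<in>V. ((\<lambda>\<alpha>. dist_pt N z (Cn \<alpha>)) \<longlongrightarrow> dist_pt N z C) (net_filter D le))"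

definition slice_converges :: "'v::real_vector set \<Rightarrow> ('v \<Rightarrow> real) \<Rightarrow>
    'i set \<Rightarrow> ('i \<Rightarrow> 'i \<Rightarrow> bool) \<Rightarrow> ('i \<Rightarrow> 'v set) \<Rightarrow> 'v set \<Rightarrow> bool" where
  "slice_converges V N D le Cn C \<longleftrightarrow>
     (\<forall>W. closed_convex_in V N W \<and> Metric_space.mbounded V (ndist V N) W \<longrightarrow>
        ((\<lambda>\<alpha>. dist_sets N W (Cn \<alpha>)) \<longlongrightarrow> dist_sets N W C) (net_filter D le))"

definition mosco_lower :: "('v::real_vector \<Rightarrow> real) \<Rightarrow>
    'i set \<Rightarrow> ('i \<Rightarrow> 'i \<Rightarrow> bool) \<Rightarrow> ('i \<Rightarrow> 'v set) \<Rightarrow> 'v set \<Rightarrow> bool" where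
  "mosco_lower N D le Cn C \<longleftrightarrow>
     (\<forall>z\<in>C. ((\<lambda>\<alpha>. dist_pt N z (Cn \<alpha>)) \<longlongrightarrow> 0) (net_filter D le))"

definition mosco_upper_subnet :: "'v::real_vector set \<Rightarrow> ('v \<Rightarrow> real) \<Rightarrow>
    'i set \<Rightarrow> ('i \<Rightarrow> 'i \<Rightarrow> bool) \<Rightarrow> ('i \<Rightarrow> 'v set) \<Rightarrow> 'v set \<Rightarrow>
    'j set \<Rightarrow> ('j \<Rightarrow> 'j \<Rightarrow> bool) \<Rightarrow> ('j \<Rightarrow> 'i) \<Rightarrow> ('j \<Rightarrow> 'v) \<Rightarrow> 'v \<Rightarrow> bool" where
  "mosco_upper_subnet V N D le Cn C B leB \<phi> \<zeta> z \<longleftrightarrow>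
     (subnet D le B leB \<phi> \<and> (\<forall>\<beta>\<in>B. \<zeta> \<beta> \<in> Cn (\<phi> \<beta>)) \<and>
      relatively_weakly_compact V N (\<zeta> ` B) \<and>
      limitin (weak_topology V N) \<zeta> z (net_filter B leB)
      \<longrightarrow> z \<in> C)"

text \<open>
  A definition cannot quantify over all index types of subnets.  It suffices to let the index
  sets range over the type below: see \<open>mosco_upper_any_index\<close>.
\<close>

definition mosco_upper :: "'v::real_vector set \<Rightarrow> ('v \<Rightarrow> real) \<Rightarrow>
    'i set \<Rightarrow> ('i \<Rightarrow> 'i \<Rightarrow> bool) \<Rightarrow> ('i \<Rightarrow> 'v set) \<Rightarrow> 'v set \<Rightarrow> bool" where
  "mosco_upper V N D le Cn C \<longleftrightarrow>
     (\<forall>(B :: (('i \<times> 'v) set \<times> 'i \<times> 'v) set) leB \<phi> \<zeta> z.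
        mosco_upper_subnet V N D le Cn C B leB \<phi> \<zeta> z)"

definition mosco_converges :: "'v::real_vector set \<Rightarrow> ('v \<Rightarrow> real) \<Rightarrow>
    'i set \<Rightarrow> ('i \<Rightarrow> 'i \<Rightarrow> bool) \<Rightarrow> ('i \<Rightarrow> 'v set) \<Rightarrow> 'v set \<Rightarrow> bool" where
  "mosco_converges V N D le Cn C \<longleftrightarrow>
     mosco_lower N D le Cn C \<and> mosco_upper V N D le Cn C"

lemma relatively_weakly_compact_mono:
  assumes "relatively_weakly_compact V N S" "T \<subseteq> S"
  shows "relatively_weakly_compact V N T"
  using assms closed_compactin[OF _ closure_of_mono[OF assms(2)] closedin_closure_of]
  unfolding relatively_weakly_compact_def by blast

lemma mosco_upper_any_index:
  fixes V :: "'v::real_vector set" and D :: "'i set" and B :: "'j set"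
  assumes up: "mosco_upper V N D le Cn C"
  shows "mosco_upper_subnet V N D le Cn C B leB \<phi> \<zeta> z"
  unfolding mosco_upper_subnet_def
proof (intro impI, elim conjE)
  assume sub: "subnet D le B leB \<phi>" and mem: "\<forall>\<beta>\<in>B. \<zeta> \<beta> \<in> Cn (\<phi> \<beta>)"
    and rc: "relatively_weakly_compact V N (\<zeta> ` B)"
    and lim: "limitin (weak_topology V N) \<zeta> z (net_filter B leB)"
  have dirB: "directed_set B leB" and im: "\<phi> ` B \<subseteq> D"
    and cof: "\<And>a. a \<in> D \<Longrightarrow> \<exists>b\<in>B. \<forall>b'\<in>B. leB b b' \<longrightarrow> le a (\<phi> b')"
    using sub unfolding subnet_def by auto
  have ne: "B \<noteq> {}" and refl: "\<And>a. a \<in> B \<Longrightarrow> leB a a"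
    and trans: "\<And>a b c. a \<in> B \<Longrightarrow> b \<in> B \<Longrightarrow> c \<in> B \<Longrightarrow> leB a b \<Longrightarrow> leB b c \<Longrightarrow> leB a c"
    and dir: "\<And>a b. a \<in> B \<Longrightarrow> b \<in> B \<Longrightarrow> \<exists>c\<in>B. leB a c \<and> leB b c"
    using dirB unfolding directed_set_def by (blast, blast, blast, blast)
  define T where "T b = (\<lambda>b'. (\<phi> b', \<zeta> b')) ` {b'\<in>B. leB b b'}" for b
  define B' where "B' = {(S, p). \<exists>b\<in>B. S = T b \<and> p \<in> S}"
  define le' :: "('i \<times> 'v) set \<times> 'i \<times> 'v \<Rightarrow> ('i \<times> 'v) set \<times> 'i \<times> 'v \<Rightarrow> bool"
    where "le' = (\<lambda>s t. fst t \<subseteq> fst s)"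
  define \<phi>' :: "('i \<times> 'v) set \<times> 'i \<times> 'v \<Rightarrow> 'i" where "\<phi>' = (\<lambda>s. fst (snd s))"
  define \<zeta>' :: "('i \<times> 'v) set \<times> 'i \<times> 'v \<Rightarrow> 'v" where "\<zeta>' = (\<lambda>s. snd (snd s))"
  have inB': "(T b, \<phi> b, \<zeta> b) \<in> B'" if "b \<in> B" for b
    using that refl by (auto simp: B'_def T_def)
  have B'D: "\<exists>b'\<in>B. \<phi>' s = \<phi> b' \<and> \<zeta>' s = \<zeta> b'" if "s \<in> B'" for s
    using that by (auto simp: B'_def T_def \<phi>'_def \<zeta>'_def)
  have tail: "\<exists>b'\<in>B. leB b b' \<and> \<phi>' s = \<phi> b' \<and> \<zeta>' s = \<zeta> b'"
    if "s \<in> B'" "le' (T b, \<phi> b, \<zeta> b) s" for s b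
  proof -
    have "snd s \<in> T b" using that by (auto simp: B'_def le'_def)
    then show ?thesis by (auto simp: T_def \<phi>'_def \<zeta>'_def)
  qed
  have Tanti: "T c \<subseteq> T b" if "b \<in> B" "c \<in> B" "leB b c" for b c
    using that trans unfolding T_def by blast
  have dir': "directed_set B' le'"
    unfolding directed_set_def
  proof (intro conjI ballI impI)
    show "B' \<noteq> {}" using ne inB' by blast
  next
    fix s t assume "s \<in> B'" "t \<in> B'"
    then obtain b c where b: "b \<in> B" "fst s = T b" and c: "c \<in> B" "fst t = T c"
      by (auto simp: B'_def)
    obtain d where d: "d \<in> B" "leB b d" "leB c d" using dir b c by blast
    then have "le' s (T d, \<phi> d, \<zeta> d)" "le' t (T d, \<phi> d, \<zeta> d)"
      using Tanti b c by (simp_all add: le'_def)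
    then show "\<exists>u\<in>B'. le' s u \<and> le' t u" using inB'[OF d(1)] by blast
  qed (auto simp: le'_def)
  have "subnet D le B' le' \<phi>'"
    unfolding subnet_def
  proof (intro conjI ballI)
    show "directed_set B' le'" by (rule dir')
    show "\<phi>' ` B' \<subseteq> D" using B'D im by fastforce
    fix a assume "a \<in> D"
    then obtain b where b: "b \<in> B" "\<forall>b'\<in>B. leB b b' \<longrightarrow> le a (\<phi> b')" using cof by blast
    show "\<exists>s\<in>B'. \<forall>s'\<in>B'. le' s s' \<longrightarrow> le a (\<phi>' s')"
    proof (intro bexI[OF _ inB'[OF b(1)]] ballI impI)
      fix s' assume "s' \<in> B'" "le' (T b, \<phi> b, \<zeta> b) s'"
      then show "le a (\<phi>' s')" using tail b(2) by metis
    qed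
  qed
  moreover have "\<forall>\<beta>\<in>B'. \<zeta>' \<beta> \<in> Cn (\<phi>' \<beta>)"
    using B'D mem by fastforce
  moreover have "relatively_weakly_compact V N (\<zeta>' ` B')"
    using rc by (rule relatively_weakly_compact_mono) (use B'D in fastforce)
  moreover have "limitin (weak_topology V N) \<zeta>' z (net_filter B' le')"
    unfolding limitin_def
  proof (intro conjI allI impI)
    show "z \<in> topspace (weak_topology V N)" using lim by (simp add: limitin_def)
    fix U assume "openin (weak_topology V N) U \<and> z \<in> U"
    then have "eventually (\<lambda>b. \<zeta> b \<in> U) (net_filter B leB)"
      using lim by (simp add: limitin_def)
    then obtain b where b: "b \<in> B" "\<forall>b'\<in>B. leB b b' \<longrightarrow> \<zeta> b' \<in> U"
      by (auto simp: eventually_net_filter[OF dirB])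
    show "eventually (\<lambda>b. \<zeta>' b \<in> U) (net_filter B' le')"
      unfolding eventually_net_filter[OF dir']
    proof (intro bexI[OF _ inB'[OF b(1)]] ballI impI)
      fix s' assume "s' \<in> B'" "le' (T b, \<phi> b, \<zeta> b) s'"
      then show "\<zeta>' s' \<in> U" using tail b(2) by metis
    qed
  qed
  ultimately show "z \<in> C"
    using up[unfolded mosco_upper_def, rule_format, of B' le' \<phi>' \<zeta>' z]
    unfolding mosco_upper_subnet_def by simp
qed

text \<open>
  In existence statements about Banach spaces the space is sought among the linear subspaces of
  the real vector space \<open>\<ell>\<^sub>\<infinity>\<close>, represented as \<open>nat \<Rightarrow>\<^sub>C real\<close>, each with an arbitrary complete norm
  unrelated to the supremum norm.  Up to isometric isomorphism this covers every separable
  Banach space.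
\<close>

type_synonym ambient = "nat \<Rightarrow>\<^sub>C real"

end

theory Submission
  imports Defs
begin

text \<open>
  For slice convergence, the distance from a bounded convex \<open>W \<subseteq> X\<close> to a subset of \<open>Y\<close> is controlled by
  the trace \<open>V = {y \<in> Y. d(y, W) \<le> r}\<close>, which is closed, bounded and convex in \<open>Y\<close>: if \<open>r < d(W, C)\<close>
  then \<open>d(V, C) > 0\<close>, so eventually \<open>C\<^sub>\<alpha>\<close> misses \<open>V\<close>, that is, \<open>d(W, C\<^sub>\<alpha>) \<ge> r\<close>.  For Mosco convergence,
  the Hahn--Banach theorem shows that \<open>Y\<close> is weakly closed in \<open>X\<close> and that its weak topology is the
  one induced from \<open>X\<close>.

  The counterexample lives in \<open>X = \<ell>\<^sub>\<infinity>\<close>.  Let \<open>u\<^sub>n\<close> be the indicator of \<open>{n, n + 1, \<dots>}\<close>.  The segments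
  \<open>[0, u\<^sub>n]\<close> converge Wijsman to \<open>{0}\<close>, since the elements of \<open>[0, u\<^sub>n]\<close> vanish on more and more coordinates.
  However, some norm-one functional \<open>f\<close> satisfies \<open>f u\<^sub>n = 1\<close> for all \<open>n\<close>, and with
  \<open>M(x, s) = max \<parallel>x\<parallel> \<bar>f x + 2 s\<bar>\<close> the point \<open>(0, 1)\<close> has distance \<open>2\<close> from the origin but distance
  at most \<open>1\<close> from every \<open>(u\<^sub>n, 0)\<close>.
\<close>

section \<open>The Hahn--Banach theorem\<close>

definition sublinear_on :: "'v::real_vector set \<Rightarrow> ('v \<Rightarrow> real) \<Rightarrow> bool" where
  "sublinear_on V p \<longleftrightarrow>
     (\<forall>x\<in>V. \<forall>y\<in>V. p (x + y) \<le> p x + p y) \<and> (\<forall>c\<ge>0. \<forall>x\<in>V. p (c *\<^sub>R x) = c * p x)"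

lemma sublinear_on_add: "sublinear_on V p \<Longrightarrow> x \<in> V \<Longrightarrow> y \<in> V \<Longrightarrow> p (x + y) \<le> p x + p y"
  by (simp add: sublinear_on_def)

lemma sublinear_on_scale: "sublinear_on V p \<Longrightarrow> c \<ge> 0 \<Longrightarrow> x \<in> V \<Longrightarrow> p (c *\<^sub>R x) = c * p x"
  by (simp add: sublinear_on_def)

text \<open>Subadditivity for the splitting \<open>y = - x + (x + y)\<close>. It keeps the infima
  formed below finite.\<close>

lemma sublinear_on_lower_bound:
  assumes "subspace V" "sublinear_on V p" "x \<in> V" "y \<in> V"
  shows "p y - p (- x) \<le> p (x + y)"
proof -
  have "p (- x + (x + y)) \<le> p (- x) + p (x + y)"
    using assms by (intro sublinear_on_add) (auto intro: subspace_neg subspace_add)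
  then show ?thesis by simp
qed

text \<open>One inequality for \<open>c > 0\<close> suffices: the same inequality with factor
  \<open>1 / c\<close> at \<open>c *\<^sub>R x\<close> gives the reverse one. Infima of sublinear
  functions are easily bounded in this one direction.\<close>

lemma sublinear_onI:
  assumes V: "subspace V" and zero: "q 0 = 0"
    and add: "\<And>x y. x \<in> V \<Longrightarrow> y \<in> V \<Longrightarrow> q (x + y) \<le> q x + q y"
    and scale: "\<And>c x. c > 0 \<Longrightarrow> x \<in> V \<Longrightarrow> q (c *\<^sub>R x) \<le> c * q x"
  shows "sublinear_on V q"
proof -
  have "q (c *\<^sub>R x) = c * q x" if "c \<ge> 0" "x \<in> V" for c x
  proof (cases "c = 0")
    case False
    then have c: "c > 0" using that by simp
    have "q ((1 / c) *\<^sub>R (c *\<^sub>R x)) \<le> (1 / c) * q (c *\<^sub>R x)"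
      using c that V by (intro scale) (auto intro: subspace_scale)
    then have "c * q x \<le> q (c *\<^sub>R x)" using c by (simp add: field_simps)
    then show ?thesis using scale[OF c that(2)] by simp
  qed (simp add: zero)
  then show ?thesis using add by (simp add: sublinear_on_def)
qed

text \<open>
  A pair \<open>(k, c)\<close> of the cone stands for the constraint \<open>c \<le> f k\<close> on the functional sought.  Graphs of
  functionals yield extensions; the cone spanned by \<open>(x, d)\<close> and \<open>Y \<times> {0}\<close> yields separation of \<open>x\<close> from \<open>Y\<close>.
\<close>

definition cone_with_heights :: "('v::real_vector \<times> real) set \<Rightarrow> bool" where
  "cone_with_heights K \<longleftrightarrow> 0 \<in> K \<and> (\<forall>a\<in>K. \<forall>b\<in>K. a + b \<in> K) \<and> (\<forall>t>0. \<forall>a\<in>K. t *\<^sub>R a \<in> K)"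

text \<open>The infimum of \<open>p (x + k) - c\<close> over \<open>(k, c)\<close> in
  \<open>K\<close> works: the pair \<open>(0, 0)\<close> gives \<open>q \<le> p\<close>, and
  \<open>x = - k\<close> gives \<open>q (- k) \<le> p 0 - c = - c\<close>. Every linear functional
  below \<open>q\<close> then satisfies all constraints in \<open>K\<close>.\<close>

lemma sublinear_on_below_cone:
  fixes p :: "'v::real_vector \<Rightarrow> real"
  assumes V: "subspace V" and p: "sublinear_on V p"
    and K: "cone_with_heights K" "fst ` K \<subseteq> V" and dom: "\<And>k c. (k, c) \<in> K \<Longrightarrow> c \<le> p k"
  obtains q where "sublinear_on V q" "\<And>x. x \<in> V \<Longrightarrow> q x \<le> p x"
    "\<And>k c. (k, c) \<in> K \<Longrightarrow> q (- k) \<le> - c"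
proof -
  define g where "g x = (\<lambda>a. p (x + fst a) - snd a)" for x :: 'v
  define q where "q x = (INF a\<in>K. g x a)" for x
  have K0: "(0, 0) \<in> K" and Kadd: "\<And>a b. a \<in> K \<Longrightarrow> b \<in> K \<Longrightarrow> a + b \<in> K"
    and Kscale: "\<And>t a. t > 0 \<Longrightarrow> a \<in> K \<Longrightarrow> t *\<^sub>R a \<in> K"
    using K(1) by (auto simp: cone_with_heights_def zero_prod_def)
  have KV: "fst a \<in> V" if "a \<in> K" for a using K(2) that by blast
  have p0: "p 0 = 0" using sublinear_on_scale[OF p, of 0 0] V by (simp add: subspace_0)
  \<comment> \<open>Domination \<open>c \<le> p k\<close> is what bounds the infimum from below,
    uniformly in the cone element.\<close>
  have low: "- p (- x) \<le> g x a" if "x \<in> V" "a \<in> K" for x a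
    using sublinear_on_lower_bound[OF V p that(1) KV[OF that(2)]] dom[of "fst a" "snd a"] that(2)
    by (simp add: g_def)
  have le: "q x \<le> g x a" if "x \<in> V" "a \<in> K" for x a
    unfolding q_def by (rule cINF_lower[OF bdd_belowI2 that(2)]) (rule low[OF that(1)])
  have ge: "m \<le> q x" if "\<And>a. a \<in> K \<Longrightarrow> m \<le> g x a" for m x
    unfolding q_def by (rule cINF_greatest) (use K0 that in auto)
  have q_le: "q x \<le> p x" if "x \<in> V" for x
    using le[OF that K0] by (simp add: g_def)
  have "sublinear_on V q"
  proof (rule sublinear_onI[OF V])
    have "0 \<le> q 0" by (rule ge) (use low[OF subspace_0[OF V]] p0 in simp)
    then show "q 0 = 0" using q_le[OF subspace_0[OF V]] p0 by simp
  next
    fix x y assume xy: "x \<in> V" "y \<in> V"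
    \<comment> \<open>Subadditivity involves two infima; each is isolated in turn so that
      \<open>ge\<close> applies. Sums of cone elements stay in the cone, so \<open>a + b\<close>
      competes in the infimum for \<open>x + y\<close>.\<close>
    have "q (x + y) - q y \<le> q x"
    proof (rule ge)
      fix a assume a: "a \<in> K"
      have "q (x + y) - g x a \<le> q y"
      proof (rule ge)
        fix b assume b: "b \<in> K"
        have "q (x + y) \<le> g (x + y) (a + b)" using xy a b V by (intro le Kadd subspace_add)
        also have "g (x + y) (a + b) = p ((x + fst a) + (y + fst b)) - snd a - snd b"
          by (simp add: g_def algebra_simps)
        also have "p ((x + fst a) + (y + fst b)) \<le> p (x + fst a) + p (y + fst b)"
          using xy a b V by (intro sublinear_on_add[OF p] subspace_add KV)
        finally show "q (x + y) - g x a \<le> g y b" by (simp add: g_def)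
      qed
      then show "q (x + y) - q y \<le> g x a" by simp
    qed
    then show "q (x + y) \<le> q x + q y" by simp
  next
    fix c :: real and x assume c: "c > 0" and x: "x \<in> V"
    have "q (c *\<^sub>R x) / c \<le> q x"
    proof (rule ge)
      fix a assume a: "a \<in> K"
      have "q (c *\<^sub>R x) \<le> g (c *\<^sub>R x) (c *\<^sub>R a)"
        using c x a V by (intro le Kscale subspace_scale)
      also have "\<dots> = p (c *\<^sub>R (x + fst a)) - c * snd a" by (simp add: g_def scaleR_right_distrib)
      also have "p (c *\<^sub>R (x + fst a)) = c * p (x + fst a)"
        using c x a V by (intro sublinear_on_scale[OF p] subspace_add KV) auto
      finally show "q (c *\<^sub>R x) / c \<le> g x a" using c by (simp add: g_def field_simps)
    qed
    then show "q (c *\<^sub>R x) \<le> c * q x" using c by (simp add: field_simps)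
  qed
  moreover have "q (- k) \<le> - c" if "(k, c) \<in> K" for k c
    using le[OF _ that, of "- k"] KV[OF that] p0 subspace_neg[OF V] by (simp add: g_def)
  ultimately show thesis using that q_le by blast
qed

text \<open>Zorn's lemma for the reversed pointwise order: the pointwise infimum of a nonempty chain
  is again sublinear and below \<open>p\<close>.\<close>

lemma minimal_sublinear_below:
  fixes p :: "'v::real_vector \<Rightarrow> real"
  assumes V: "subspace V" and p: "sublinear_on V p"
  obtains q where "sublinear_on V q" "\<And>x. x \<in> V \<Longrightarrow> q x \<le> p x"
    "\<forall>r. sublinear_on V r \<longrightarrow> (\<forall>x\<in>V. r x \<le> q x) \<longrightarrow> (\<forall>x\<in>V. r x = q x)"
proof -
  \<comment> \<open>Functions are made zero off \<open>V\<close> so that the pointwise order is antisymmetric.\<close>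
  define A where "A = {q. sublinear_on V q \<and> (\<forall>x\<in>V. q x \<le> p x) \<and> (\<forall>x. x \<notin> V \<longrightarrow> q x = 0)}"
  define R :: "('v \<Rightarrow> real) \<Rightarrow> ('v \<Rightarrow> real) \<Rightarrow> bool" where "R q r \<longleftrightarrow> r \<le> q" for q r
  have restrict: "sublinear_on V (\<lambda>x. if x \<in> V then r x else 0)" if "sublinear_on V r" for r
    using that V by (simp add: sublinear_on_def subspace_add subspace_scale)
  have "\<exists>m\<in>A. \<forall>a\<in>A. R m a \<longrightarrow> a = m"
  proof (rule predicate_Zorn)
    show "partial_order_on A (relation_of R A)"
      by (rule partial_order_on_relation_ofI) (auto simp: R_def)
  next
    fix C assume C: "C \<in> Chains (relation_of R A)"
    have CA: "q \<in> A" if "q \<in> C" for q using Chains_relation_of[OF C] that by blast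
    have tot: "q \<le> r \<or> r \<le> q" if "q \<in> C" "r \<in> C" for q r
      using C that by (auto simp: Chains_def relation_of_def R_def)
    show "\<exists>u\<in>A. \<forall>a\<in>C. R a u"
    proof (cases "C = {}")
      case True
      have "(\<lambda>x. if x \<in> V then p x else 0) \<in> A" using restrict[OF p] by (simp add: A_def)
      with True show ?thesis by blast
    next
      case False
      define u where "u x = (INF q\<in>C. q x)" for x
      have sub: "sublinear_on V q" "\<And>x. x \<in> V \<Longrightarrow> q x \<le> p x" "\<And>x. x \<notin> V \<Longrightarrow> q x = 0"
        if "q \<in> C" for q using CA[OF that] by (auto simp: A_def)
      have q0: "q 0 = 0" if "q \<in> C" for q
        using sublinear_on_scale[OF sub(1)[OF that], of 0 0] V by (simp add: subspace_0)
      \<comment> \<open>The bound is \<open>- p (- x)\<close> on \<open>V\<close> and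
        \<open>0\<close> off \<open>V\<close>; the minimum covers both cases at once.\<close>
      have low: "min 0 (- p (- x)) \<le> q x" if "q \<in> C" for q x
      proof (cases "x \<in> V")
        case True
        then show ?thesis
          using sublinear_on_lower_bound[OF V sub(1)[OF that], of x 0] q0[OF that]
            sub(2)[OF that, of "- x"] V by (simp add: subspace_0 subspace_neg)
      qed (simp add: sub(3)[OF that])
      have le: "u x \<le> q x" if "q \<in> C" for q x
        unfolding u_def by (rule cINF_lower[OF bdd_belowI2 that]) (rule low)
      have ge: "m \<le> u x" if "\<And>q. q \<in> C \<Longrightarrow> m \<le> q x" for m x
        unfolding u_def by (rule cINF_greatest[OF False that])
      have "sublinear_on V u"
      proof (rule sublinear_onI[OF V])
        have "(\<lambda>q. q 0) ` C = {0}" using q0 False by force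
        then show "u 0 = 0" by (simp add: u_def)
      next
        fix x y assume xy: "x \<in> V" "y \<in> V"
        have "u (x + y) - u y \<le> u x"
        proof (rule ge)
          fix q assume q: "q \<in> C"
          have "u (x + y) - q x \<le> u y"
          proof (rule ge)
            fix r assume r: "r \<in> C"
            \<comment> \<open>Only here is the chain property needed: one member lies below both
              \<open>q\<close> and \<open>r\<close>, and its subadditivity is used.\<close>
            obtain s where s: "s \<in> C" "s \<le> q" "s \<le> r" using tot[OF q r] q r by blast
            have "u (x + y) \<le> s x + s y"
              using le[OF s(1)] sublinear_on_add[OF sub(1)[OF s(1)] xy] by (rule order_trans)
            also have "\<dots> \<le> q x + r y" using s(2,3) by (simp add: le_fun_def add_mono)
            finally show "u (x + y) - q x \<le> r y" by simp
          qed
          then show "u (x + y) - u y \<le> q x" by simp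
        qed
        then show "u (x + y) \<le> u x + u y" by simp
      next
        fix c :: real and x assume c: "c > 0" and x: "x \<in> V"
        have "u (c *\<^sub>R x) / c \<le> u x"
          by (rule ge) (use c x le[of _ "c *\<^sub>R x"] sublinear_on_scale[OF sub(1), of _ c x]
              in \<open>auto simp: field_simps\<close>)
        then show "u (c *\<^sub>R x) \<le> c * u x" using c by (simp add: field_simps)
      qed
      moreover obtain q where "q \<in> C" using False by blast
      moreover from this have "u x \<le> p x" if "x \<in> V" for x
        using le sub(2) that by (meson order_trans)
      moreover have "u x = 0" if "x \<notin> V" for x
      proof -
        have "(\<lambda>q. q x) ` C = {0}" using sub(3)[OF _ that] False by force
        then show ?thesis by (simp add: u_def)
      qed
      ultimately have "u \<in> A" by (simp add: A_def)
      with le show ?thesis by (auto simp: R_def le_fun_def)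
    qed
  qed
  then obtain q where q: "q \<in> A" and min: "\<And>r. r \<in> A \<Longrightarrow> r \<le> q \<Longrightarrow> r = q"
    by (auto simp: R_def)
  show thesis
  proof (rule that)
    show "sublinear_on V q" using q by (simp add: A_def)
    show qp: "\<And>x. x \<in> V \<Longrightarrow> q x \<le> p x" using q by (simp add: A_def)
    show "\<forall>r. sublinear_on V r \<longrightarrow> (\<forall>x\<in>V. r x \<le> q x) \<longrightarrow> (\<forall>x\<in>V. r x = q x)"
    proof (intro allI impI ballI)
      fix r x assume r: "sublinear_on V r" "\<forall>x\<in>V. r x \<le> q x" and x: "x \<in> V"
      \<comment> \<open>Minimality is known only within \<open>A\<close>, so the competitor is first
        cut off outside \<open>V\<close>.\<close>
      define r' where "r' = (\<lambda>x. if x \<in> V then r x else 0)"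
      have "r' \<in> A" using restrict[OF r(1)] r(2) qp by (force simp: A_def r'_def)
      moreover have "r' \<le> q" using r(2) q by (auto simp: le_fun_def r'_def A_def)
      ultimately have "r' = q" by (rule min)
      then show "r x = q x" using x by (metis r'_def)
    qed
  qed
qed

text \<open>Imposing the single constraint \<open>q y \<le> f y\<close> produces a sublinear
  function below \<open>q\<close> with value at most \<open>- q y\<close> at \<open>- y\<close>. By
  minimality it equals \<open>q\<close> on \<open>V\<close>, so \<open>q\<close> is odd there, and
  an odd sublinear function is linear.\<close>

lemma minimal_sublinear_linear:
  assumes V: "subspace V" and q: "sublinear_on V q"
    and min: "\<forall>r. sublinear_on V r \<longrightarrow> (\<forall>x\<in>V. r x \<le> q x) \<longrightarrow> (\<forall>x\<in>V. r x = q x)"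
  shows "x \<in> V \<Longrightarrow> y \<in> V \<Longrightarrow> q (x + y) = q x + q y" and "x \<in> V \<Longrightarrow> q (c *\<^sub>R x) = c * q x"
proof -
  have neg: "q (- y) = - q y" if y: "y \<in> V" for y
  proof (rule antisym)
    \<comment> \<open>The ray through \<open>(y, q y)\<close>, the smallest cone carrying that
      constraint.\<close>
    define K where "K = (\<lambda>t. t *\<^sub>R (y, q y)) ` {0..}"
    have KI: "t *\<^sub>R (y, q y) \<in> K" if "t \<ge> 0" for t using that unfolding K_def by blast
    have KE: "\<exists>t\<ge>0. a = t *\<^sub>R (y, q y)" if "a \<in> K" for a using that unfolding K_def by blast
    have "cone_with_heights K"
      unfolding cone_with_heights_def
    proof (intro conjI ballI allI impI)
      show "0 \<in> K" using KI[of 0] by (simp add: zero_prod_def)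
    next
      fix a b assume "a \<in> K" "b \<in> K"
      then obtain t s where "t \<ge> 0" "a = t *\<^sub>R (y, q y)" "s \<ge> 0" "b = s *\<^sub>R (y, q y)"
        using KE by meson
      then show "a + b \<in> K" using KI[of "t + s"] by (simp add: algebra_simps)
    next
      fix t :: real and a assume "t > 0" "a \<in> K"
      moreover from this obtain s where "s \<ge> 0" "a = s *\<^sub>R (y, q y)" using KE by meson
      ultimately show "t *\<^sub>R a \<in> K" using KI[of "t * s"] by (simp add: mult.assoc)
    qed
    moreover have "fst ` K \<subseteq> V" using V y by (auto simp: K_def subspace_scale)
    moreover have "c \<le> q k" if "(k, c) \<in> K" for k c
      using that sublinear_on_scale[OF q _ y] by (auto simp: K_def)
    ultimately obtain r where r: "sublinear_on V r" "\<And>x. x \<in> V \<Longrightarrow> r x \<le> q x"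
      "\<And>k c. (k, c) \<in> K \<Longrightarrow> r (- k) \<le> - c"
      by (rule sublinear_on_below_cone[OF V q]) blast+
    have "(y, q y) \<in> K" using KI[of 1] by simp
    then show "q (- y) \<le> - q y"
      using r(3) min[rule_format, OF r(1,2), of "- y"] subspace_neg[OF V y] by metis
    show "- q y \<le> q (- y)"
      using sublinear_on_lower_bound[OF V q, of "- y" 0] V y
        sublinear_on_scale[OF q, of 0 0] by (simp add: subspace_0 subspace_neg)
  qed
  show "q (x + y) = q x + q y" if "x \<in> V" "y \<in> V"
  proof -
    \<comment> \<open>Oddness turns this into superadditivity at \<open>x\<close> and
      \<open>y\<close>.\<close>
    have "q (- x + - y) \<le> q (- x) + q (- y)"
      using that V by (intro sublinear_on_add[OF q] subspace_neg)
    moreover have "q (- x + - y) = - q (x + y)"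
      using neg[of "x + y"] that V by (simp add: subspace_add)
    ultimately show ?thesis
      using neg that sublinear_on_add[OF q that] by simp
  qed
  show "q (c *\<^sub>R x) = c * q x" if x: "x \<in> V"
  proof (cases "c \<ge> 0")
    case False
    have "q (- ((- c) *\<^sub>R x)) = - q ((- c) *\<^sub>R x)"
      using V x by (intro neg subspace_scale)
    then show ?thesis using sublinear_on_scale[OF q _ x, of "- c"] False by simp
  qed (simp add: sublinear_on_scale[OF q _ x])
qed

text \<open>First \<open>p\<close> is lowered to a \<open>q\<close> that absorbs the constraints; a
  minimal sublinear \<open>f\<close> below \<open>q\<close> is linear, and
  \<open>f (- k) \<le> q (- k) \<le> - c\<close> is the constraint at \<open>(k, c)\<close>.\<close>

theorem Hahn_Banach_cone:
  assumes V: "subspace V" and p: "sublinear_on V p"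
    and K: "cone_with_heights K" "fst ` K \<subseteq> V" and dom: "\<And>k c. (k, c) \<in> K \<Longrightarrow> c \<le> p k"
  obtains f where "\<And>x y. x \<in> V \<Longrightarrow> y \<in> V \<Longrightarrow> f (x + y) = f x + f y"
    "\<And>c x. x \<in> V \<Longrightarrow> f (c *\<^sub>R x) = c * f x"
    "\<And>x. x \<in> V \<Longrightarrow> f x \<le> p x" "\<And>k c. (k, c) \<in> K \<Longrightarrow> c \<le> f k"
proof -
  obtain q where q: "sublinear_on V q" "\<And>x. x \<in> V \<Longrightarrow> q x \<le> p x"
    "\<And>k c. (k, c) \<in> K \<Longrightarrow> q (- k) \<le> - c"
    using sublinear_on_below_cone[OF assms] by blast
  obtain f where f: "sublinear_on V f" "\<And>x. x \<in> V \<Longrightarrow> f x \<le> q x"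
    and min: "\<forall>r. sublinear_on V r \<longrightarrow> (\<forall>x\<in>V. r x \<le> f x) \<longrightarrow> (\<forall>x\<in>V. r x = f x)"
    using minimal_sublinear_below[OF V q(1)] by metis
  note lin = minimal_sublinear_linear[OF V f(1) min]
  show thesis
  proof (rule that)
    show "f (x + y) = f x + f y" if "x \<in> V" "y \<in> V" for x y using lin(1) that by blast
    show "f (c *\<^sub>R x) = c * f x" if "x \<in> V" for c x using lin(2) that by blast
    show "f x \<le> p x" if "x \<in> V" for x using f(2) q(2) that by (meson order_trans)
    show "c \<le> f k" if kc: "(k, c) \<in> K" for k c
    proof -
      have k: "k \<in> V" using K(2) kc by force
      then have "f (- k) \<le> - c" using f(2) q(3)[OF kc] subspace_neg[OF V] by (meson order_trans)
      then show ?thesis using lin(2)[of k "-1"] k by simp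
    qed
  qed
qed

section \<open>Norms on subspaces\<close>

lemma norm_on_subspace: "norm_on V N \<Longrightarrow> subspace V"
  by (simp add: norm_on_def)

lemma norm_on_add: "norm_on V N \<Longrightarrow> x \<in> V \<Longrightarrow> y \<in> V \<Longrightarrow> N (x + y) \<le> N x + N y"
  by (simp add: norm_on_def)

lemma norm_on_scale: "norm_on V N \<Longrightarrow> x \<in> V \<Longrightarrow> N (c *\<^sub>R x) = \<bar>c\<bar> * N x"
  by (simp add: norm_on_def)

lemma norm_on_zero: "norm_on V N \<Longrightarrow> N 0 = 0"
  by (simp add: norm_on_def subspace_0)

lemma norm_on_minus_commute:
  assumes "norm_on V N" "x \<in> V" "y \<in> V"
  shows "N (x - y) = N (y - x)"
  using norm_on_scale[OF assms(1), of "x - y" "-1"]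
    subspace_diff[OF norm_on_subspace[OF assms(1)] assms(2,3)] by simp

lemma norm_on_triangle:
  assumes "norm_on V N" "x \<in> V" "y \<in> V" "z \<in> V"
  shows "N (x - z) \<le> N (x - y) + N (y - z)"
  using norm_on_add[OF assms(1), of "x - y" "y - z"] subspace_diff[OF norm_on_subspace[OF assms(1)]] assms
  by simp

lemma norm_on_mono:
  assumes "norm_on X N" "subspace Y" "Y \<subseteq> X" "\<And>y. y \<in> Y \<Longrightarrow> M y = N y"
  shows "norm_on Y M"
proof -
  have "M (x + y) \<le> M x + M y" if "x \<in> Y" "y \<in> Y" for x y
    using that assms norm_on_add[OF assms(1), of x y] by (auto simp: subspace_add subset_eq)
  moreover have "M (c *\<^sub>R x) = \<bar>c\<bar> * M x" if "x \<in> Y" for c x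
    using that assms norm_on_scale[OF assms(1), of x c] by (auto simp: subspace_scale subset_eq)
  moreover have "M x = 0 \<longleftrightarrow> x = 0" if "x \<in> Y" for x
    using that assms by (auto simp: norm_on_def subset_eq)
  ultimately show ?thesis using assms(2) by (simp add: norm_on_def)
qed

lemma sublinear_on_norm:
  assumes "norm_on V N" "K \<ge> 0"
  shows "sublinear_on V (\<lambda>x. K * N x)"
  unfolding sublinear_on_def
  using norm_on_add[OF assms(1)] norm_on_scale[OF assms(1)] assms(2)
  by (auto simp: distrib_left[symmetric] intro: mult_left_mono)

text \<open>The bound at \<open>- x\<close> supplies the missing side; domination by a sublinear
  function is only one-sided.\<close>

lemma abs_le_norm_onI:
  assumes N: "norm_on V N" and x: "x \<in> V"
    and hom: "\<And>c x. x \<in> V \<Longrightarrow> f (c *\<^sub>R x) = c * f x" and le: "\<And>x. x \<in> V \<Longrightarrow> f x \<le> K * N x"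
  shows "\<bar>f x\<bar> \<le> K * N x"
proof -
  have "f (- x) \<le> K * N (- x)" using le subspace_neg[OF norm_on_subspace[OF N] x] .
  then show ?thesis
    using le[OF x] hom[OF x, of "-1"] norm_on_scale[OF N x, of "-1"] by simp
qed

text \<open>The cone is the graph of \<open>f\<close>. Its constraints say
  \<open>f y \<le> g y\<close>, and those at \<open>y\<close> and \<open>- y\<close> together force
  equality.\<close>

lemma dual_on_extension:
  assumes N: "norm_on X N" and Y: "subspace Y" "Y \<subseteq> X" and f: "f \<in> dual_on Y N"
  obtains g where "g \<in> dual_on X N" "\<And>y. y \<in> Y \<Longrightarrow> g y = f y"
proof -
  obtain K0 where K0: "\<And>y. y \<in> Y \<Longrightarrow> \<bar>f y\<bar> \<le> K0 * N y"
    using f unfolding dual_on_def by blast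
  \<comment> \<open>The given bound may be negative when \<open>Y\<close> is trivial, whereas the
    majorant must be sublinear.\<close>
  define K where "K = max 0 K0"
  have "K \<ge> 0" by (simp add: K_def)
  have K: "f y \<le> K * N y" if "y \<in> Y" for y
    using K0[OF that] mult_right_mono[of K0 K "N y"] norm_on_nonneg[OF N, of y] that Y
    by (auto simp: K_def)
  define G where "G = (\<lambda>y. (y, f y)) ` Y"
  have fadd: "\<And>x y. x \<in> Y \<Longrightarrow> y \<in> Y \<Longrightarrow> f (x + y) = f x + f y"
    and fhom: "\<And>c x. x \<in> Y \<Longrightarrow> f (c *\<^sub>R x) = c * f x"
    using f by (auto simp: dual_on_def)
  have G: "(y, f y) \<in> G" if "y \<in> Y" for y using that by (simp add: G_def)
  have f0: "f 0 = 0" using fhom[OF subspace_0[OF Y(1)], of 0] by simp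
  have "cone_with_heights G"
    unfolding cone_with_heights_def
  proof (intro conjI ballI allI impI)
    show "0 \<in> G" using G[OF subspace_0[OF Y(1)]] f0 by (simp add: zero_prod_def)
    show "a + b \<in> G" if "a \<in> G" "b \<in> G" for a b
      using that Y(1) fadd by (auto simp: G_def subspace_add image_iff)
    show "t *\<^sub>R a \<in> G" if "a \<in> G" for t a
      using that Y(1) fhom by (auto simp: G_def subspace_scale image_iff)
  qed
  moreover have "fst ` G \<subseteq> X" using Y(2) by (auto simp: G_def)
  moreover have "c \<le> K * N k" if "(k, c) \<in> G" for k c using that K by (auto simp: G_def)
  ultimately obtain g where g: "\<And>x y. x \<in> X \<Longrightarrow> y \<in> X \<Longrightarrow> g (x + y) = g x + g y"
    "\<And>c x. x \<in> X \<Longrightarrow> g (c *\<^sub>R x) = c * g x"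
    "\<And>x. x \<in> X \<Longrightarrow> g x \<le> K * N x" "\<And>k c. (k, c) \<in> G \<Longrightarrow> c \<le> g k"
    using Hahn_Banach_cone[OF norm_on_subspace[OF N] sublinear_on_norm[OF N \<open>K \<ge> 0\<close>], of G] by blast
  show thesis
  proof (rule that)
    show "g \<in> dual_on X N"
      unfolding dual_on_def using g(1,2) abs_le_norm_onI[OF N _ g(2,3)] by blast
    show "g y = f y" if y: "y \<in> Y" for y
    proof -
      have "f (- y) \<le> g (- y)" using g(4) G subspace_neg[OF Y(1) y] by blast
      moreover have "f (- y) = - f y" "g (- y) = - g y"
        using fhom[OF y, of "-1"] g(2)[of y "-1"] y Y(2) by auto
      ultimately show ?thesis using g(4)[OF G[OF y]] by simp
    qed
  qed
qed

text \<open>The cone consists of the pairs \<open>(t *\<^sub>R x - y, t * d)\<close>. Those with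
  \<open>t = 0\<close> force \<open>f\<close> to vanish on \<open>Y\<close>, and
  \<open>t = 1\<close>, \<open>y = 0\<close> gives \<open>d \<le> f x\<close>. Domination by
  \<open>N\<close> is the distance hypothesis scaled by \<open>t\<close>.\<close>

lemma dual_on_separation:
  assumes N: "norm_on X N" and Y: "subspace Y" "Y \<subseteq> X" and x: "x \<in> X"
    and d: "d \<ge> 0" "\<And>y. y \<in> Y \<Longrightarrow> d \<le> N (x - y)"
  obtains f where "f \<in> dual_on X N" "\<And>v. v \<in> X \<Longrightarrow> \<bar>f v\<bar> \<le> N v" "\<And>y. y \<in> Y \<Longrightarrow> f y = 0" "d \<le> f x"
proof -
  note X = norm_on_subspace[OF N]
  define K where "K = (\<lambda>(t, y). (t *\<^sub>R x - y, t * d)) ` ({0..} \<times> Y)"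
  have KI: "(t *\<^sub>R x - y, t * d) \<in> K" if "t \<ge> 0" "y \<in> Y" for t y
    using that by (force simp: K_def)
  have "cone_with_heights K"
    unfolding cone_with_heights_def
  proof (intro conjI ballI allI impI)
    show "0 \<in> K" using KI[of 0 0] subspace_0[OF Y(1)] by (simp add: zero_prod_def)
  next
    fix a b assume "a \<in> K" "b \<in> K"
    then obtain t y s z where *: "t \<ge> 0" "y \<in> Y" "s \<ge> 0" "z \<in> Y"
      "a = (t *\<^sub>R x - y, t * d)" "b = (s *\<^sub>R x - z, s * d)"
      by (auto simp: K_def)
    show "a + b \<in> K" using KI[of "t + s" "y + z"] * Y(1) by (simp add: algebra_simps subspace_add)
  next
    fix t :: real and a assume "t > 0" "a \<in> K"
    then obtain s y where *: "s \<ge> 0" "y \<in> Y" "a = (s *\<^sub>R x - y, s * d)" by (auto simp: K_def)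
    show "t *\<^sub>R a \<in> K"
      using KI[of "t * s" "t *\<^sub>R y"] * Y(1) \<open>t > 0\<close> by (simp add: algebra_simps subspace_scale)
  qed
  moreover have "fst ` K \<subseteq> X"
    using X Y x by (auto simp: K_def intro!: subspace_diff subspace_scale)
  moreover have "c \<le> 1 * N k" if kc: "(k, c) \<in> K" for k c
  proof -
    obtain t y where *: "t \<ge> 0" "y \<in> Y" "k = t *\<^sub>R x - y" "c = t * d" using kc by (auto simp: K_def)
    show ?thesis
    proof (cases "t = 0")
      case True
      then show ?thesis using * norm_on_nonneg[OF N, of k] X Y by (auto simp: subspace_neg)
    next
      case False
      have y': "(1 / t) *\<^sub>R y \<in> Y" using Y(1) *(2) by (rule subspace_scale)
      have "k = t *\<^sub>R (x - (1 / t) *\<^sub>R y)" using False * by (simp add: scaleR_right_diff_distrib)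
      then have "N k = t * N (x - (1 / t) *\<^sub>R y)"
        using norm_on_scale[OF N, of "x - (1 / t) *\<^sub>R y" t] y' Y(2) x X *(1)
        by (auto simp: subspace_diff subset_eq)
      then show ?thesis using *(1,4) d(2)[OF y'] by (simp add: mult_left_mono)
    qed
  qed
  ultimately obtain f where f: "\<And>x y. x \<in> X \<Longrightarrow> y \<in> X \<Longrightarrow> f (x + y) = f x + f y"
    "\<And>c x. x \<in> X \<Longrightarrow> f (c *\<^sub>R x) = c * f x"
    "\<And>x. x \<in> X \<Longrightarrow> f x \<le> 1 * N x" "\<And>k c. (k, c) \<in> K \<Longrightarrow> c \<le> f k"
    using Hahn_Banach_cone[OF X sublinear_on_norm[OF N zero_le_one], of K] by blast
  have bound: "\<bar>f v\<bar> \<le> 1 * N v" if "v \<in> X" for v by (rule abs_le_norm_onI[OF N that f(2,3)])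
  show thesis
  proof (rule that)
    show "f \<in> dual_on X N" unfolding dual_on_def using f(1,2) bound by blast
    show "\<bar>f v\<bar> \<le> N v" if "v \<in> X" for v using bound[OF that] by simp
    show "f y = 0" if y: "y \<in> Y" for y
    proof -
      have "0 \<le> f (- y)" "0 \<le> f y"
        using f(4)[OF KI[of 0]] y subspace_neg[OF Y(1) y] by fastforce+
      then show ?thesis using f(2)[of y "-1"] y Y(2) by auto
    qed
    show "d \<le> f x" using f(4)[OF KI[of 1 0]] subspace_0[OF Y(1)] by simp
  qed
qed

section \<open>The weak topology of a subspace\<close>

lemma weak_topology_basis:
  "f \<in> dual_on V N \<Longrightarrow> open U \<Longrightarrow> openin (weak_topology V N) {x \<in> V. f x \<in> U}"
  unfolding weak_topology_def by (rule topology_generated_by_Basis) blast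

text \<open>Only subbasic sets need checking. Continuity of \<open>id\<close> serves to compare
  topologies.\<close>

lemma continuous_map_into_weak_topology:
  assumes "\<And>f U. f \<in> dual_on V N \<Longrightarrow> open U \<Longrightarrow> openin T {x \<in> topspace T. f x \<in> U}"
    and sub: "topspace T \<subseteq> V"
  shows "continuous_map T (weak_topology V N) id"
  unfolding weak_topology_def
proof (rule continuous_on_generated_topo)
  fix U assume "U \<in> {{x \<in> V. f x \<in> U} |f U. f \<in> dual_on V N \<and> open U}"
  then obtain f W where f: "f \<in> dual_on V N" "open W" "U = {x \<in> V. f x \<in> W}" by blast
  have "id -` U \<inter> topspace T = {x \<in> topspace T. f x \<in> W}" using sub f(3) by auto
  then show "openin T (id -` U \<inter> topspace T)" using assms(1)[OF f(1,2)] by simp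
next
  show "id ` topspace T \<subseteq> \<Union>{{x \<in> V. f x \<in> U} |f U. f \<in> dual_on V N \<and> open U}"
    using sub topspace_weak_topology[of V N] by (simp add: weak_topology_def)
qed

text \<open>Functionals on \<open>X\<close> restrict to \<open>Y\<close>, and by Hahn--Banach
  functionals on \<open>Y\<close> extend to \<open>X\<close>, so the two topologies have the same
  subbasic sets. The norms need to agree only on \<open>Y\<close>.\<close>

lemma weak_topology_subspace:
  assumes N: "norm_on X N" and Y: "subspace Y" "Y \<subseteq> X" and M: "\<And>y. y \<in> Y \<Longrightarrow> M y = N y"
  shows "weak_topology Y M = subtopology (weak_topology X N) Y"
proof -
  let ?S = "subtopology (weak_topology X N) Y"
  have dual: "dual_on Y M = dual_on Y N" using M by (simp add: dual_on_def)
  have top: "topspace ?S = Y" using Y(2) by (auto simp: topspace_weak_topology)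
  have "continuous_map ?S (weak_topology Y M) id"
  proof (rule continuous_map_into_weak_topology)
    fix f and U :: "real set" assume "f \<in> dual_on Y M" and U: "open U"
    then have "f \<in> dual_on Y N" by (simp add: dual)
    then obtain g where g: "g \<in> dual_on X N" "\<And>y. y \<in> Y \<Longrightarrow> g y = f y"
      by (rule dual_on_extension[OF N Y]) blast
    have "{x \<in> topspace ?S. f x \<in> U} = {x \<in> X. g x \<in> U} \<inter> Y"
      unfolding top using g(2) Y(2) by auto
    then show "openin ?S {x \<in> topspace ?S. f x \<in> U}"
      using weak_topology_basis[OF g(1) U] by (auto simp: openin_subtopology)
  qed (simp add: top)
  moreover have "continuous_map (weak_topology Y M) (weak_topology X N) id"
  proof (rule continuous_map_into_weak_topology)
    fix f and U :: "real set" assume f: "f \<in> dual_on X N" and U: "open U"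
    have "f \<in> dual_on Y N" using f Y(2) unfolding dual_on_def by blast
    then have "f \<in> dual_on Y M" by (simp add: dual)
    then show "openin (weak_topology Y M) {x \<in> topspace (weak_topology Y M). f x \<in> U}"
      using weak_topology_basis[OF _ U] by (simp add: topspace_weak_topology)
  qed (simp add: topspace_weak_topology Y(2))
  then have "continuous_map (weak_topology Y M) ?S id"
    by (auto simp: continuous_map_in_subtopology topspace_weak_topology)
  ultimately show ?thesis
    unfolding topology_eq
    by (metis topology_finer_continuous_id top topspace_weak_topology)
qed

text \<open>Replaces balls for the cut-off distance \<open>ndist\<close> by a positive gap measured
  with \<open>N\<close> alone.\<close>

lemma closedin_norm_topology:
  assumes "norm_on V N"
  shows "closedin (norm_topology V N) A \<longleftrightarrow>
    A \<subseteq> V \<and> (\<forall>x\<in>V - A. \<exists>r>0. \<forall>a\<in>A. r \<le> N (x - a))"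
proof -
  interpret Metric_space V "ndist V N" by (rule Metric_space_ndist[OF assms])
  have "disjnt A (mball x r) \<longleftrightarrow> (\<forall>a\<in>A. r \<le> N (x - a))" if "A \<subseteq> V" "x \<in> V" for x r
    using that by (fastforce simp: disjnt_def ndist_def)
  then show ?thesis by (auto simp: norm_topology_def closedin_metric)
qed

lemma mbounded_ndist:
  assumes "norm_on V N"
  shows "Metric_space.mbounded V (ndist V N) A \<longleftrightarrow> A \<subseteq> V \<and> (\<exists>B. \<forall>a\<in>A. N a \<le> B)"
proof -
  note V = norm_on_subspace[OF assms]
  interpret Metric_space V "ndist V N" by (rule Metric_space_ndist[OF assms])
  show ?thesis
  proof
    assume "mbounded A"
    then obtain x B where B: "A \<subseteq> mcball x B" by (auto simp: mbounded_def)
    have "N a \<le> N x + B" if "a \<in> A" for a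
    proof -
      have "x \<in> V" "a \<in> V" "N (x - a) \<le> B"
        using subsetD[OF B that] by (auto simp: ndist_def)
      moreover have "N (a - 0) \<le> N (a - x) + N (x - 0)"
        using calculation V by (intro norm_on_triangle[OF assms]) (auto simp: subspace_0)
      ultimately show ?thesis using norm_on_minus_commute[OF assms, of a x] by simp
    qed
    then show "A \<subseteq> V \<and> (\<exists>B. \<forall>a\<in>A. N a \<le> B)" using B by fastforce
  next
    assume "A \<subseteq> V \<and> (\<exists>B. \<forall>a\<in>A. N a \<le> B)"
    then obtain B where B: "A \<subseteq> V" "\<And>a. a \<in> A \<Longrightarrow> N a \<le> B" by blast
    have "A \<subseteq> mcball 0 B"
    proof
      fix a assume a: "a \<in> A"
      then have "N (0 - a) = N a" using norm_on_scale[OF assms, of a "-1"] B(1) by auto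
      then show "a \<in> mcball 0 B" using a B V by (auto simp: ndist_def subspace_0)
    qed
    then show "mbounded A" by (auto simp: mbounded_def)
  qed
qed

text \<open>A point off \<open>Y\<close> has positive distance from \<open>Y\<close>, so some
  functional vanishes on \<open>Y\<close> and is positive at the point; its open half-space is a
  weak neighbourhood missing \<open>Y\<close>.\<close>

lemma weakly_closed_subspace:
  assumes N: "norm_on X N" and Y: "subspace Y" and cl: "closedin (norm_topology X N) Y"
  shows "closedin (weak_topology X N) Y"
proof -
  have YX: "Y \<subseteq> X" and sep: "\<And>x. x \<in> X - Y \<Longrightarrow> \<exists>r>0. \<forall>y\<in>Y. r \<le> N (x - y)"
    using cl by (auto simp: closedin_norm_topology[OF N])
  have "\<exists>T. openin (weak_topology X N) T \<and> x \<in> T \<and> T \<subseteq> X - Y" if x: "x \<in> X - Y" for x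
  proof -
    obtain r where r: "r > 0" "\<And>y. y \<in> Y \<Longrightarrow> r \<le> N (x - y)" using sep[OF x] by blast
    obtain f where f: "f \<in> dual_on X N" "\<And>y. y \<in> Y \<Longrightarrow> f y = 0" "r \<le> f x"
      using dual_on_separation[OF N Y YX _ _ r(2)] x r(1) by (metis DiffD1 less_imp_le)
    have "openin (weak_topology X N) {v \<in> X. f v \<in> {0<..}}"
      by (intro weak_topology_basis f open_greaterThan)
    then show ?thesis using f r x by (intro exI[of _ "{v \<in> X. f v \<in> {0<..}}"]) auto
  qed
  then show ?thesis
    unfolding closedin_def topspace_weak_topology using YX openin_subopen by metis
qed

section \<open>Mosco and slice convergence in a superspace\<close>

lemma superspaceD:
  assumes "superspace X NX Y NY"
  shows "norm_on X NX" "subspace Y" "Y \<subseteq> X" "closedin (norm_topology X NX) Y"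
    "\<And>y. y \<in> Y \<Longrightarrow> NY y = NX y"
  using assms by (auto simp: superspace_def banach_on_def)

lemma eventually_in_net_filter:
  assumes "directed_set D le"
  shows "eventually (\<lambda>\<alpha>. \<alpha> \<in> D) (net_filter D le)"
  unfolding eventually_net_filter[OF assms] using assms unfolding directed_set_def by blast

lemma net_filter_neq_bot:
  assumes "directed_set D le"
  shows "net_filter D le \<noteq> bot"
proof
  assume "net_filter D le = bot"
  then have "eventually (\<lambda>_. False) (net_filter D le)" by simp
  then show False
    unfolding eventually_net_filter[OF assms] using assms unfolding directed_set_def by blast
qed

lemma dist_pt_superspace:
  assumes "superspace X NX Y NY" "z \<in> Y" "A \<subseteq> Y"
  shows "dist_pt NX z A = dist_pt NY z A"
  unfolding dist_pt_def
  using assms superspaceD(2,5)[OF assms(1)] by (intro INF_cong) (auto simp: subspace_diff subset_eq)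

text \<open>The lower condition only measures distances inside \<open>Y\<close>. For the upper one,
  a weak limit in \<open>X\<close> stays in the weakly closed set \<open>Y\<close>, and weak
  convergence and relative weak compactness pass to \<open>Y\<close> because the topologies
  agree.\<close>

lemma mosco_converges_superspace:
  assumes sup: "superspace X NX Y NY" and D: "directed_set D le"
    and Cn: "\<And>\<alpha>. \<alpha> \<in> D \<Longrightarrow> Cn \<alpha> \<subseteq> Y" and C: "C \<subseteq> Y"
    and conv: "mosco_converges Y NY D le Cn C"
  shows "mosco_converges X NX D le Cn C"
proof -
  note X = superspaceD[OF sup]
  have "mosco_lower NX D le Cn C"
    unfolding mosco_lower_def
  proof
    fix z assume z: "z \<in> C"
    \<comment> \<open>The inclusion \<open>Cn \<alpha> \<subseteq> Y\<close> is known only for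
      indices in \<open>D\<close>, hence equality only eventually.\<close>
    have "eventually (\<lambda>\<alpha>. dist_pt NX z (Cn \<alpha>) = dist_pt NY z (Cn \<alpha>)) (net_filter D le)"
      using eventually_in_net_filter[OF D]
      by (rule eventually_mono) (use z C Cn in \<open>intro dist_pt_superspace[OF sup], auto\<close>)
    moreover have "((\<lambda>\<alpha>. dist_pt NY z (Cn \<alpha>)) \<longlongrightarrow> 0) (net_filter D le)"
      using conv z by (simp add: mosco_converges_def mosco_lower_def)
    ultimately show "((\<lambda>\<alpha>. dist_pt NX z (Cn \<alpha>)) \<longlongrightarrow> 0) (net_filter D le)"
      by (simp add: tendsto_cong)
  qed
  moreover have "mosco_upper X NX D le Cn C"
    unfolding mosco_upper_def mosco_upper_subnet_def
  proof (intro allI impI, elim conjE)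
    fix B :: "(('b \<times> 'a) set \<times> 'b \<times> 'a) set" and leB \<phi> \<zeta> z
    assume sub: "subnet D le B leB \<phi>" and mem: "\<forall>\<beta>\<in>B. \<zeta> \<beta> \<in> Cn (\<phi> \<beta>)"
      and rc: "relatively_weakly_compact X NX (\<zeta> ` B)"
      and lim: "limitin (weak_topology X NX) \<zeta> z (net_filter B leB)"
    have B: "directed_set B leB" and \<phi>: "\<phi> ` B \<subseteq> D" using sub by (auto simp: subnet_def)
    have \<zeta>: "\<zeta> \<beta> \<in> Y" if "\<beta> \<in> B" for \<beta> using that mem \<phi> Cn by blast
    have ev: "eventually (\<lambda>\<beta>. \<zeta> \<beta> \<in> Y) (net_filter B leB)"
      using eventually_in_net_filter[OF B] by (rule eventually_mono) (rule \<zeta>)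
    note closed = weakly_closed_subspace[OF X(1,2,4)]
    note weak = weak_topology_subspace[where M = NY, OF X(1,2,3,5)]
    have "z \<in> Y" using limitin_closedin[OF lim closed ev] net_filter_neq_bot[OF B] by simp
    then have "limitin (weak_topology Y NY) \<zeta> z (net_filter B leB)"
      using ev lim by (simp add: weak limitin_subtopology)
    \<comment> \<open>Thus the closures in \<open>X\<close> and in \<open>Y\<close> are the same
      set, and its compactness carries over.\<close>
    moreover have "weak_topology X NX closure_of (\<zeta> ` B) \<subseteq> Y"
      by (rule closure_of_minimal[OF _ closed]) (use \<zeta> in blast)
    then have "relatively_weakly_compact Y NY (\<zeta> ` B)"
      using rc \<zeta> unfolding relatively_weakly_compact_def
      by (auto simp: weak closure_of_subtopology compactin_subtopology
          Int_absorb1 Int_absorb2 image_subset_iff)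
    moreover have "mosco_upper_subnet Y NY D le Cn C B leB \<phi> \<zeta> z"
      using conv by (intro mosco_upper_any_index) (simp add: mosco_converges_def)
    ultimately show "z \<in> C" using sub mem unfolding mosco_upper_subnet_def by blast
  qed
  ultimately show ?thesis by (simp add: mosco_converges_def)
qed

section \<open>Enlargements of convex sets and slice convergence\<close>

lemma dist_sets_less_iff:
  "dist_sets N A B < r \<longleftrightarrow> (\<exists>a\<in>A. \<exists>b\<in>B. ereal (N (a - b)) < r)"
  by (simp add: dist_sets_def INF_less_iff)

text \<open>The set is \<open>{y \<in> Y. d(y, W) \<le> r}\<close> written without an infimum; it is
  empty for empty \<open>W\<close>. It is closed and convex because the distance to a convex set is
  continuous and convex.\<close>

lemma closed_convex_in_enlargement:
  assumes N: "norm_on X N" and Y: "subspace Y" "Y \<subseteq> X" and M: "\<And>y. y \<in> Y \<Longrightarrow> M y = N y"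
    and W: "convex W" "W \<subseteq> X"
  shows "closed_convex_in Y M {y \<in> Y. \<forall>e>r. \<exists>w\<in>W. N (y - w) < e}" (is "closed_convex_in _ _ ?V")
proof -
  have "norm_on Y M" by (rule norm_on_mono[OF N Y M])
  show ?thesis
    unfolding closed_convex_in_def closedin_norm_topology[OF \<open>norm_on Y M\<close>]
  proof (intro conjI ballI)
    show "?V \<subseteq> Y" by blast
  next
    fix x assume "x \<in> Y - ?V"
    then obtain e where x: "x \<in> Y" and e: "e > r" "\<And>w. w \<in> W \<Longrightarrow> e \<le> N (x - w)"
      by (auto simp: not_less)
    have "(e - r) / 2 \<le> M (x - v)" if v: "v \<in> ?V" for v
    proof -
      \<comment> \<open>Half of the gap \<open>e - r\<close> pays for a nearly nearest
        \<open>w\<close>; the other half separates \<open>x\<close> from \<open>v\<close>.\<close>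
      have "r + (e - r) / 2 > r" using e(1) by simp
      then obtain w where w: "w \<in> W" "N (v - w) < r + (e - r) / 2" using v by blast
      have "N (x - w) \<le> N (x - v) + N (v - w)"
        using x v w(1) W(2) Y(2) by (intro norm_on_triangle[OF N]) auto
      moreover have "M (x - v) = N (x - v)" using x v Y(1) by (intro M) (auto simp: subspace_diff)
      ultimately show ?thesis using e(2)[OF w(1)] w(2) by (simp add: field_simps)
    qed
    then show "\<exists>d>0. \<forall>v\<in>?V. d \<le> M (x - v)" using e(1) by (intro exI[of _ "(e - r) / 2"]) auto
  next
    show "convex ?V"
    proof (rule convexI)
      fix x y and s t :: real
      assume x: "x \<in> ?V" and y: "y \<in> ?V" and st: "0 \<le> s" "0 \<le> t" "s + t = 1"
      have "\<exists>w\<in>W. N (s *\<^sub>R x + t *\<^sub>R y - w) < e" if e: "e > r" for e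
      proof -
        obtain v w where v: "v \<in> W" "N (x - v) < e" and w: "w \<in> W" "N (y - w) < e"
          using x y e by blast
        have xv: "x - v \<in> X" "y - w \<in> X"
          using x y v w W(2) Y(2) norm_on_subspace[OF N] by (auto intro!: subspace_diff)
        have "N (s *\<^sub>R x + t *\<^sub>R y - (s *\<^sub>R v + t *\<^sub>R w)) = N (s *\<^sub>R (x - v) + t *\<^sub>R (y - w))"
          by (simp add: algebra_simps)
        also have "\<dots> \<le> s * N (x - v) + t * N (y - w)"
          using norm_on_add[OF N, of "s *\<^sub>R (x - v)" "t *\<^sub>R (y - w)"] norm_on_scale[OF N] xv st
            norm_on_subspace[OF N] by (simp add: subspace_scale)
        also have "\<dots> < e" using v(2) w(2) st by (intro convex_bound_lt)
        finally show ?thesis using W(1) v(1) w(1) st by (auto simp: convex_def)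
      qed
      then show "s *\<^sub>R x + t *\<^sub>R y \<in> ?V"
        using x y Y(1) by (auto intro: subspace_add subspace_scale)
    qed
  qed
qed

text \<open>Upper estimates come from testing convergence in \<open>Y\<close> on a singleton
  \<open>{c}\<close> with \<open>c \<in> C\<close> nearly nearest to \<open>W\<close>, lower
  estimates from testing on the trace in \<open>Y\<close> of an enlargement of
  \<open>W\<close>.\<close>

lemma slice_converges_superspace:
  assumes sup: "superspace X NX Y NY" and D: "directed_set D le"
    and Cn: "\<And>\<alpha>. \<alpha> \<in> D \<Longrightarrow> Cn \<alpha> \<subseteq> Y" and C: "C \<subseteq> Y"
    and conv: "slice_converges Y NY D le Cn C"
  shows "slice_converges X NX D le Cn C"
  unfolding slice_converges_def
proof (intro allI impI, elim conjE)
  note X = superspaceD[OF sup]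
  have normY: "norm_on Y NY" by (rule norm_on_mono[OF X(1,2,3,5)])
  have diff: "x - y \<in> Y" if "x \<in> Y" "y \<in> Y" for x y using X(2) that by (rule subspace_diff)
  have convY: "((\<lambda>\<alpha>. dist_sets NY V (Cn \<alpha>)) \<longlongrightarrow> dist_sets NY V C) (net_filter D le)"
    if "closed_convex_in Y NY V" "V \<subseteq> Y" "\<And>v. v \<in> V \<Longrightarrow> NY v \<le> B" for V B
    using conv that unfolding slice_converges_def mbounded_ndist[OF normY] by blast
  fix W assume "closed_convex_in X NX W" and "Metric_space.mbounded X (ndist X NX) W"
  then obtain B where W: "convex W" "W \<subseteq> X" and B: "\<And>w. w \<in> W \<Longrightarrow> NX w \<le> B"
    unfolding closed_convex_in_def mbounded_ndist[OF X(1)] by blast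
  show "((\<lambda>\<alpha>. dist_sets NX W (Cn \<alpha>)) \<longlongrightarrow> dist_sets NX W C) (net_filter D le)"
  proof (rule order_tendstoI)
    fix a assume "dist_sets NX W C < a"
    then obtain w c where wc: "w \<in> W" "c \<in> C" "ereal (NX (w - c)) < a"
      by (auto simp: dist_sets_less_iff)
    \<comment> \<open>The slack \<open>m - NX (w - c)\<close> is what may be spent on moving from
      \<open>c\<close> to a point of \<open>Cn \<alpha>\<close>.\<close>
    then obtain m where m: "NX (w - c) < m" "ereal m < a" using ereal_dense2 by force
    have cY: "c \<in> Y" using wc(2) C by blast
    have "closed_convex_in Y NY {c}"
      unfolding closed_convex_in_def closedin_norm_topology[OF normY]
    proof (intro conjI ballI)
      fix x assume x: "x \<in> Y - {c}"
      then have "NY (x - c) \<noteq> 0" using normY diff cY by (simp add: norm_on_def)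
      then have "NY (x - c) > 0" using norm_on_nonneg[OF normY diff[of x c]] x cY by simp
      then show "\<exists>r>0. \<forall>v\<in>{c}. r \<le> NY (x - v)" by auto
    qed (simp_all add: cY)
    then have "((\<lambda>\<alpha>. dist_sets NY {c} (Cn \<alpha>)) \<longlongrightarrow> dist_sets NY {c} C) (net_filter D le)"
      using cY by (intro convY[where B = "NY c"]) auto
    moreover have "dist_sets NY {c} C < ereal (m - NX (w - c))"
      using wc(2) m(1) norm_on_zero[OF normY]
      by (auto simp: dist_sets_less_iff intro!: bexI[of _ c])
    ultimately have "eventually (\<lambda>\<alpha>. dist_sets NY {c} (Cn \<alpha>) < ereal (m - NX (w - c))) (net_filter D le)"
      by (rule order_tendstoD)
    with eventually_in_net_filter[OF D]
    show "eventually (\<lambda>\<alpha>. dist_sets NX W (Cn \<alpha>) < a) (net_filter D le)"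
    proof eventually_elim
      case (elim \<alpha>)
      then obtain d where d: "d \<in> Cn \<alpha>" "NY (c - d) < m - NX (w - c)"
        by (auto simp: dist_sets_less_iff)
      have dY: "d \<in> Y" using d(1) Cn[OF elim(1)] by blast
      have "NX (w - d) \<le> NX (w - c) + NX (c - d)"
        using wc(1) cY dY W(2) X(3) by (intro norm_on_triangle[OF X(1)]) auto
      then have "NX (w - d) < m" using d(2) X(5)[OF diff[OF cY dY]] by simp
      then have "ereal (NX (w - d)) < a" using m(2) by (meson ereal_less_le less_imp_le less_trans less_ereal.simps(1))
      then show ?case using wc(1) d(1) by (auto simp: dist_sets_less_iff)
    qed
  next
    fix a assume "a < dist_sets NX W C"
    \<comment> \<open>The second level \<open>s\<close> leaves a positive gap: the trace at level
      \<open>r\<close> stays at distance at least \<open>(s - r) / 2\<close> from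
      \<open>C\<close>.\<close>
    then obtain r s where r: "a < ereal r" "r < s" "ereal s < dist_sets NX W C"
      using ereal_dense2 by (metis less_ereal.simps(1))
    define V where "V = {y \<in> Y. \<forall>e>r. \<exists>w\<in>W. NX (y - w) < e}"
    have "NY v \<le> r + 1 + B" if v: "v \<in> V" for v
    proof -
      have "r + 1 > r" by simp
      then obtain w where w: "w \<in> W" "NX (v - w) < r + 1" using v unfolding V_def by blast
      have "NX (v - 0) \<le> NX (v - w) + NX (w - 0)"
        using v w(1) W(2) X(3) norm_on_subspace[OF X(1)]
        by (intro norm_on_triangle[OF X(1)]) (auto simp: V_def subspace_0)
      then show ?thesis using w B[OF w(1)] v X(5) by (simp add: V_def)
    qed
    then have "((\<lambda>\<alpha>. dist_sets NY V (Cn \<alpha>)) \<longlongrightarrow> dist_sets NY V C) (net_filter D le)"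
      using closed_convex_in_enlargement[where M = NY, OF X(1,2,3,5) W, of r]
      by (intro convY) (auto simp: V_def)
    moreover have "0 < dist_sets NY V C"
    proof -
      have "(s - r) / 2 \<le> NY (v - c)" if v: "v \<in> V" and c: "c \<in> C" for v c
      proof -
        have "r + (s - r) / 2 > r" using r(2) by simp
        then obtain w where w: "w \<in> W" "NX (v - w) < r + (s - r) / 2"
          using v unfolding V_def by blast
        have in_X: "v \<in> X" "c \<in> X" "w \<in> X" using v c w(1) C W(2) X(3) by (auto simp: V_def)
        have "\<not> ereal (NX (w - c)) < ereal s"
          using r(3) w(1) c by (meson dist_sets_less_iff less_asym)
        then have "s \<le> NX (w - c)" by simp
        also have "\<dots> \<le> NX (w - v) + NX (v - c)" by (intro norm_on_triangle[OF X(1)] in_X)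
        also have "NX (w - v) = NX (v - w)" by (intro norm_on_minus_commute[OF X(1)] in_X)
        also have "NX (v - c) = NY (v - c)" using v c C by (intro X(5)[symmetric] diff) (auto simp: V_def)
        finally show ?thesis using w(2) by (simp add: field_simps)
      qed
      then have "\<not> dist_sets NY V C < ereal ((s - r) / 2)"
        by (force simp: dist_sets_less_iff)
      moreover have "0 < ereal ((s - r) / 2)" using r(2) by simp
      ultimately show ?thesis by (meson less_le_trans not_less)
    qed
    ultimately have "eventually (\<lambda>\<alpha>. 0 < dist_sets NY V (Cn \<alpha>)) (net_filter D le)"
      by (rule order_tendstoD)
    with eventually_in_net_filter[OF D]
    show "eventually (\<lambda>\<alpha>. a < dist_sets NX W (Cn \<alpha>)) (net_filter D le)"
    proof eventually_elim
      case (elim \<alpha>)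
      \<comment> \<open>Otherwise some point of \<open>Cn \<alpha>\<close> would lie in
        \<open>V\<close>, making the distance of the two sets \<open>0\<close>.\<close>
      have "\<not> dist_sets NX W (Cn \<alpha>) < ereal r"
      proof
        assume "dist_sets NX W (Cn \<alpha>) < ereal r"
        then obtain w c where wc: "w \<in> W" "c \<in> Cn \<alpha>" "NX (w - c) < r"
          by (auto simp: dist_sets_less_iff)
        have c: "c \<in> Y" using wc(2) Cn[OF elim(1)] by blast
        have "NX (c - w) = NX (w - c)"
          using wc(1) c X(3) W(2) by (intro norm_on_minus_commute[OF X(1)]) auto
        then have "NX (c - w) < r" using wc(3) by simp
        then have "c \<in> V" using wc(1) c by (force simp: V_def)
        then have "dist_sets NY V (Cn \<alpha>) \<le> ereal (NY (c - c))"
          unfolding dist_sets_def using wc(2) by (meson INF_lower2 order_refl)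
        then show False using elim(2) norm_on_zero[OF normY] by (simp add: zero_ereal_def)
      qed
      then show ?case using r(1) by simp
    qed
  qed
qed

section \<open>A Wijsman convergent sequence that does not converge in a superspace\<close>

text \<open>The constant \<open>a\<close> makes Cauchy sequences for \<open>M\<close> Cauchy for
  \<open>N\<close>, and \<open>b\<close> carries the limits back.\<close>

lemma banach_on_equivalent_norm:
  assumes N: "banach_on V N" and M: "norm_on V M" and eq: "equivalent_norms V N M"
  shows "banach_on V M"
proof -
  have N': "norm_on V N" using N by (simp add: banach_on_def)
  note V = norm_on_subspace[OF M]
  interpret N: Metric_space V "ndist V N" by (rule Metric_space_ndist[OF N'])
  interpret M: Metric_space V "ndist V M" by (rule Metric_space_ndist[OF M])
  obtain a b where ab: "a > 0" "b > 0" "\<And>x. x \<in> V \<Longrightarrow> a * N x \<le> M x" "\<And>x. x \<in> V \<Longrightarrow> M x \<le> b * N x"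
    using eq by (auto simp: equivalent_norms_def)
  have le: "a * ndist V N x y \<le> ndist V M x y" "ndist V M x y \<le> b * ndist V N x y" for x y
    using ab subspace_diff[OF V] by (auto simp: ndist_def)
  have "M.mcomplete"
    unfolding M.mcomplete_def
  proof (intro allI impI)
    fix \<sigma> assume \<sigma>: "M.MCauchy \<sigma>"
    have "N.MCauchy \<sigma>"
      unfolding N.MCauchy_def
    proof (intro conjI allI impI)
      show "range \<sigma> \<subseteq> V" using \<sigma> by (simp add: M.MCauchy_def)
      fix e :: real assume "e > 0"
      then have "a * e > 0" using ab(1) by simp
      then obtain k where "\<And>n n'. k \<le> n \<Longrightarrow> k \<le> n' \<Longrightarrow> ndist V M (\<sigma> n) (\<sigma> n') < a * e"
        using \<sigma> unfolding M.MCauchy_def by blast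
      then have "k \<le> n \<Longrightarrow> k \<le> n' \<Longrightarrow> a * ndist V N (\<sigma> n) (\<sigma> n') < a * e" for n n'
        using le(1) by (meson le_less_trans)
      then show "\<exists>k. \<forall>n n'. k \<le> n \<longrightarrow> k \<le> n' \<longrightarrow> ndist V N (\<sigma> n) (\<sigma> n') < e"
        using ab(1) by (meson mult_less_cancel_left_pos)
    qed
    then obtain x where x: "limitin N.mtopology \<sigma> x sequentially"
      using N by (auto simp: banach_on_def N.mcomplete_def)
    have "limitin M.mtopology \<sigma> x sequentially"
      unfolding M.limitin_metric
    proof (intro conjI allI impI)
      show "x \<in> V" using x by (simp add: N.limitin_metric)
      fix e :: real assume "e > 0"
      then have "e / b > 0" using ab(2) by simp
      then have "eventually (\<lambda>n. \<sigma> n \<in> V \<and> ndist V N (\<sigma> n) x < e / b) sequentially"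
        using x by (simp add: N.limitin_metric)
      then show "eventually (\<lambda>n. \<sigma> n \<in> V \<and> ndist V M (\<sigma> n) x < e) sequentially"
      proof eventually_elim
        case (elim n)
        then have "b * ndist V N (\<sigma> n) x < e" using ab(2) by (simp add: field_simps)
        then show ?case using elim le(2)[of "\<sigma> n" x] by simp
      qed
    qed
    then show "\<exists>x. limitin M.mtopology \<sigma> x sequentially" by blast
  qed
  then show ?thesis using M by (simp add: banach_on_def)
qed

text \<open>Completeness is an assumption on \<open>UNIV\<close> instead of a class constraint, so
  that \<open>ambient\<close> and \<open>ambient \<times> real\<close> are covered.\<close>

lemma banach_on_UNIV_complete:
  assumes "complete (UNIV :: 'a::real_normed_vector set)"
  shows "banach_on (UNIV :: 'a set) norm"
proof -
  have "ndist UNIV norm = (dist :: 'a \<Rightarrow> 'a \<Rightarrow> real)"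
    by (simp add: fun_eq_iff ndist_def dist_norm)
  then show ?thesis
    using assms by (simp add: banach_on_def norm_on_def norm_triangle_ineq)
qed

lemma complete_UNIV_prod:
  assumes "complete (UNIV :: 'a::metric_space set)" "complete (UNIV :: 'b::metric_space set)"
  shows "complete (UNIV :: ('a \<times> 'b) set)"
  unfolding complete_def
proof (intro allI impI)
  fix X :: "nat \<Rightarrow> 'a \<times> 'b" assume "(\<forall>n. X n \<in> UNIV) \<and> Cauchy X"
  then have "Cauchy (\<lambda>n. fst (X n))" "Cauchy (\<lambda>n. snd (X n))"
    by (auto intro: Cauchy_fst Cauchy_snd)
  then obtain a b where "(\<lambda>n. fst (X n)) \<longlonglongrightarrow> a" "(\<lambda>n. snd (X n)) \<longlonglongrightarrow> b"
    using assms unfolding complete_def by blast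
  then have "(\<lambda>n. (fst (X n), snd (X n))) \<longlonglongrightarrow> (a, b)" by (rule tendsto_Pair)
  then show "\<exists>l\<in>UNIV. X \<longlonglongrightarrow> l" by auto
qed

text \<open>The library's completeness instance assumes a metric domain, and \<open>nat\<close> is not an instance.\<close>

lemma complete_UNIV_bcontfun:
  "complete (UNIV :: ('a::topological_space, 'b::complete_space) bcontfun set)"
  unfolding complete_def
proof (intro allI impI)
  fix f :: "nat \<Rightarrow> ('a, 'b) bcontfun" assume "(\<forall>n. f n \<in> UNIV) \<and> Cauchy f"
  then obtain g where "uniform_limit UNIV f g sequentially"
    using uniformly_convergent_eq_cauchy[of "\<lambda>_. True" f]
    unfolding Cauchy_def uniform_limit_sequentially_iff
    by (metis dist_fun_lt_imp_dist_val_lt)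
  then obtain l where "f \<longlonglongrightarrow> l" by (rule uniform_limit_bcontfunE) simp
  then show "\<exists>l\<in>UNIV. f \<longlonglongrightarrow> l" by blast
qed

lemma banach_on_ambient: "banach_on (UNIV :: ambient set) norm"
  by (rule banach_on_UNIV_complete[OF complete_UNIV_bcontfun])

section \<open>A generalized limit on bounded sequences\<close>

definition tail_indicator :: "nat \<Rightarrow> ambient" where
  "tail_indicator n = Bcontfun (\<lambda>i. if n \<le> i then 1 else 0)"

lemma apply_tail_indicator [simp]: "apply_bcontfun (tail_indicator n) i = (if n \<le> i then 1 else 0)"
  unfolding tail_indicator_def
  by (subst Bcontfun_inverse) (auto intro: bcontfun_normI[where b = 1])

text \<open>Since \<open>f\<close> vanishes on finitely supported sequences, it behaves like a generalized limit.\<close>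

lemma ex_limit_functional:
  obtains f :: "ambient \<Rightarrow> real" where "linear f" "\<And>x. \<bar>f x\<bar> \<le> norm x" "\<And>n. f (tail_indicator n) = 1"
proof -
  define Y :: "ambient set" where "Y = {y. \<exists>n. \<forall>i\<ge>n. apply_bcontfun y i = 0}"
  have Y: "subspace Y"
  proof (rule subspaceI)
    show "0 \<in> Y" by (simp add: Y_def)
    fix x y assume "x \<in> Y" "y \<in> Y"
    then obtain m n where "\<forall>i\<ge>m. apply_bcontfun x i = 0" "\<forall>i\<ge>n. apply_bcontfun y i = 0"
      by (auto simp: Y_def)
    then show "x + y \<in> Y" by (auto simp: Y_def intro!: exI[of _ "max m n"])
  next
    show "c *\<^sub>R x \<in> Y" if "x \<in> Y" for c x using that by (auto simp: Y_def)
  qed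
  \<comment> \<open>\<open>tail_indicator 0\<close> is the constant sequence \<open>1\<close>, so
    the difference has a coordinate equal to \<open>1\<close> wherever \<open>y\<close>
    vanishes.\<close>
  have one: "1 \<le> norm (tail_indicator 0 - y)" if "y \<in> Y" for y
  proof -
    obtain n where "\<forall>i\<ge>n. apply_bcontfun y i = 0" using \<open>y \<in> Y\<close> by (auto simp: Y_def)
    then have "apply_bcontfun (tail_indicator 0 - y) n = 1" by simp
    then show ?thesis using norm_bounded[of "tail_indicator 0 - y" n] by simp
  qed
  have "norm_on (UNIV :: ambient set) norm"
    using banach_on_ambient by (simp add: banach_on_def)
  then obtain f :: "ambient \<Rightarrow> real" where f: "f \<in> dual_on UNIV norm" "\<And>x. \<bar>f x\<bar> \<le> norm x"
    "\<And>y. y \<in> Y \<Longrightarrow> f y = 0" "1 \<le> f (tail_indicator 0)"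
    using dual_on_separation[of UNIV norm Y "tail_indicator 0" 1] Y one
    by (metis UNIV_I subset_UNIV zero_le_one)
  have lin: "linear f" using f(1) by (intro linearI) (auto simp: dual_on_def)
  have "norm (tail_indicator 0) \<le> 1" by (rule norm_bound) simp
  then have f0: "f (tail_indicator 0) = 1" using f(2)[of "tail_indicator 0"] f(4) by simp
  have "f (tail_indicator n) = 1" for n
  proof -
    \<comment> \<open>The difference is supported on the coordinates below \<open>n\<close>.\<close>
    have "tail_indicator 0 - tail_indicator n \<in> Y"
      by (auto simp: Y_def intro!: exI[of _ n])
    then have "f (tail_indicator 0 - tail_indicator n) = 0" by (rule f(3))
    then show ?thesis using f0 linear_diff[OF lin] by simp
  qed
  with lin f(2) that show thesis by blast
qed

section \<open>The norm on the product\<close>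

lemma equivalent_normsI:
  assumes "a > 0" "b > 0" "\<And>x. x \<in> V \<Longrightarrow> a * N x \<le> M x" "\<And>x. x \<in> V \<Longrightarrow> M x \<le> b * N x"
  shows "equivalent_norms V N M"
  using assms unfolding equivalent_norms_def by blast

text \<open>From \<open>\<bar>f x\<bar> \<le> norm x\<close> follows
  \<open>2 * \<bar>s\<bar> \<le> \<bar>f x + 2 * s\<bar> + norm x\<close>, so \<open>M\<close>
  controls both components. Equivalence with \<open>product_norm\<close> is the one wanted in the
  end; equivalence with the library norm on pairs transports completeness.\<close>

lemma norm_on_extension:
  fixes f :: "'a::real_normed_vector \<Rightarrow> real"
  assumes f: "linear f" "\<And>x. \<bar>f x\<bar> \<le> norm x"
  defines "M \<equiv> \<lambda>(x, s). max (norm x) \<bar>f x + 2 * s\<bar>"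
  shows "norm_on UNIV M" and "equivalent_norms UNIV (product_norm norm) M"
    and "equivalent_norms UNIV norm M"
proof -
  have lower: "\<bar>s\<bar> \<le> M (x, s)" "norm x \<le> M (x, s)" for x s
    using f(2)[of x] by (auto simp: M_def)
  have upper: "M (x, s) \<le> norm x + 2 * \<bar>s\<bar>" for x s
    using f(2)[of x] by (auto simp: M_def)
  show "norm_on UNIV M"
    unfolding norm_on_def
  proof (intro conjI ballI allI)
    show "M z = 0 \<longleftrightarrow> z = 0" for z
      using lower[where x = "fst z" and s = "snd z"] upper[of "fst z" "snd z"]
      by (cases z) (auto simp: zero_prod_def)
    show "M (z + z') \<le> M z + M z'" for z z'
    proof -
      have max_add: "max a b \<le> max c d + max c' d'" if "a \<le> c + c'" "b \<le> d + d'"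
        for a b c d c' d' :: real using that by linarith
      show ?thesis
        unfolding M_def split_beta fst_add snd_add linear_add[OF f(1)]
        by (intro max_add norm_triangle_ineq) (simp add: abs_triangle_ineq[THEN order_trans])
    qed
    show "M (c *\<^sub>R z) = \<bar>c\<bar> * M z" for c z
    proof (cases z)
      case (Pair x s)
      have "\<bar>f (c *\<^sub>R x) + 2 * (c * s)\<bar> = \<bar>c\<bar> * \<bar>f x + 2 * s\<bar>"
        by (simp add: linear_scale[OF f(1)] abs_mult[symmetric] algebra_simps)
      then show ?thesis by (simp add: Pair M_def max_mult_distrib_left)
    qed
  qed simp
  show "equivalent_norms UNIV (product_norm norm) M"
  proof (rule equivalent_normsI)
    fix z :: "'a \<times> real"
    obtain x s where z: "z = (x, s)" by (cases z)
    show "1 / 2 * product_norm norm z \<le> M z"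
      using lower[where x = x and s = s] by (simp add: z product_norm_def)
    show "M z \<le> 2 * product_norm norm z"
    proof -
      note upper
      also have "norm x + 2 * \<bar>s\<bar> \<le> 2 * product_norm norm z" by (simp add: z product_norm_def)
      finally show ?thesis by (simp add: z)
    qed
  qed simp_all
  show "equivalent_norms UNIV norm M"
  proof (rule equivalent_normsI)
    fix z :: "'a \<times> real"
    obtain x s where z: "z = (x, s)" by (cases z)
    show "1 / 2 * norm z \<le> M z"
      using lower[where x = x and s = s] norm_Pair_le[of x s] by (simp add: z)
    show "M z \<le> 3 * norm z"
      using upper[of x s] norm_fst_le[of x s] norm_snd_le[of s x] by (simp add: z)
  qed simp_all
qed

text \<open>All segments contain \<open>0\<close>, which bounds the distances by
  \<open>norm z\<close>. Conversely, a coordinate of \<open>z\<close> that nearly attains the norm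
  is eventually untouched by the segments.\<close>

lemma wijsman_tail_indicator:
  "wijsman_converges UNIV norm UNIV (\<le>) (\<lambda>n. closed_segment 0 (tail_indicator n)) {0}"
  unfolding wijsman_converges_def
proof (intro ballI)
  have dir: "directed_set (UNIV :: nat set) (\<le>)"
    by (auto simp: directed_set_def intro: max.cobounded1 max.cobounded2)
  fix z :: ambient
  have zero: "dist_pt norm z {0} = ereal (norm z)" by (simp add: dist_pt_def)
  show "((\<lambda>n. dist_pt norm z (closed_segment 0 (tail_indicator n))) \<longlongrightarrow> dist_pt norm z {0})
    (net_filter UNIV (\<le>))"
    unfolding zero
  proof (rule order_tendstoI)
    fix a assume a: "ereal (norm z) < a"
    have "dist_pt norm z (closed_segment 0 (tail_indicator n)) < a" for n
      unfolding dist_pt_def INF_less_iff using a by (intro bexI[of _ 0]) auto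
    then show "eventually (\<lambda>n. dist_pt norm z (closed_segment 0 (tail_indicator n)) < a)
      (net_filter UNIV (\<le>))" by simp
  next
    fix a assume a: "a < ereal (norm z)"
    obtain b where b: "a < ereal b" "b < norm z" using ereal_dense2[OF a] by auto
    obtain i where i: "b < \<bar>apply_bcontfun z i\<bar>"
      using norm_bound[of z b] b(2) by (metis not_le real_norm_def)
    \<comment> \<open>\<open>tail_indicator n\<close> is already \<open>1\<close> at coordinate
      \<open>n\<close>, so vanishing at \<open>i\<close> requires \<open>n\<close> strictly above
      \<open>i\<close>.\<close>
    have "a < dist_pt norm z (closed_segment 0 (tail_indicator n))" if n: "Suc i \<le> n" for n
    proof -
      have "b \<le> norm (z - c)" if c: "c \<in> closed_segment 0 (tail_indicator n)" for c
      proof -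
        have "apply_bcontfun c i = 0"
          using c n by (auto simp: closed_segment_def)
        then show ?thesis using i norm_bounded[of "z - c" i] by simp
      qed
      then have "ereal b \<le> dist_pt norm z (closed_segment 0 (tail_indicator n))"
        unfolding dist_pt_def by (intro INF_greatest) simp
      then show ?thesis using b(1) by simp
    qed
    then show "eventually (\<lambda>n. a < dist_pt norm z (closed_segment 0 (tail_indicator n)))
      (net_filter UNIV (\<le>))"
      unfolding eventually_net_filter[OF dir] by blast
  qed
qed

lemma wijsman_not_preserved:
  "\<exists>(X :: ambient set) N M (D :: nat set) le Cn C.
        banach_on X N \<and>
        banach_on (X \<times> (UNIV :: real set)) M \<and>
        equivalent_norms (X \<times> (UNIV :: real set)) (product_norm N) M \<and>
        (\<forall>x\<in>X. M (x, 0) = N x) \<and>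
        directed_set D le \<and>
        (\<forall>\<alpha>\<in>D. closed_convex_in X N (Cn \<alpha>)) \<and> closed_convex_in X N C \<and>
        wijsman_converges X N D le Cn C \<and>
        \<not> wijsman_converges (X \<times> (UNIV :: real set)) M D le (\<lambda>\<alpha>. Cn \<alpha> \<times> {0}) (C \<times> {0})"
proof -
  obtain f :: "ambient \<Rightarrow> real" where f: "linear f" "\<And>x. \<bar>f x\<bar> \<le> norm x"
    and f1: "\<And>n. f (tail_indicator n) = 1" by (rule ex_limit_functional) blast
  define M where "M = (\<lambda>(x, s). max (norm x) \<bar>f x + 2 * s\<bar>)"
  note M = norm_on_extension[OF f, folded M_def]
  define Cn where "Cn n = closed_segment 0 (tail_indicator n)" for n
  have dir: "directed_set (UNIV :: nat set) (\<le>)"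
    by (auto simp: directed_set_def intro: max.cobounded1 max.cobounded2)
  have f0: "f 0 = 0" by (rule linear_0[OF f(1)])
  have "ndist UNIV norm = (dist :: ambient \<Rightarrow> ambient \<Rightarrow> real)"
    by (simp add: fun_eq_iff ndist_def dist_norm)
  then have closed: "closed_convex_in UNIV norm A \<longleftrightarrow> closed A \<and> convex A" for A :: "ambient set"
    by (simp add: closed_convex_in_def norm_topology_def)
  have "\<not> wijsman_converges (UNIV \<times> UNIV) M UNIV (\<le>) (\<lambda>n. Cn n \<times> {0}) ({0} \<times> {0})"
  proof
    assume "wijsman_converges (UNIV \<times> UNIV) M UNIV (\<le>) (\<lambda>n. Cn n \<times> {0}) ({0} \<times> {0})"
    then have "((\<lambda>n. dist_pt M (0, 1) (Cn n \<times> {0})) \<longlongrightarrow> dist_pt M (0, 1) ({0} \<times> {0}))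
      (net_filter UNIV (\<le>))"
      by (simp add: wijsman_converges_def)
    \<comment> \<open>The distance is \<open>2\<close>, since
      \<open>f 0 + 2 * 1 = 2\<close>.\<close>
    moreover have "ereal 1 < dist_pt M (0, 1) ({0} \<times> {0})" by (simp add: dist_pt_def M_def f0)
    ultimately have "eventually (\<lambda>n. ereal 1 < dist_pt M (0, 1) (Cn n \<times> {0})) (net_filter UNIV (\<le>))"
      by (rule order_tendstoD)
    then obtain n where n: "ereal 1 < dist_pt M (0, 1) (Cn n \<times> {0})"
      by (auto simp: eventually_net_filter[OF dir])
    have "norm (tail_indicator n) \<le> 1" by (rule norm_bound) simp
    \<comment> \<open>Subtracting \<open>tail_indicator n\<close> lowers the second term of the
      maximum to \<open>\<bar>- 1 + 2\<bar> = 1\<close>.\<close>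
    then have "M ((0, 1) - (tail_indicator n, 0)) \<le> 1"
      by (simp add: M_def linear_neg[OF f(1)] f1)
    moreover have "dist_pt M (0, 1) (Cn n \<times> {0}) \<le> ereal (M ((0, 1) - (tail_indicator n, 0)))"
      unfolding dist_pt_def by (rule INF_lower) (simp add: Cn_def)
    ultimately show False using n by (meson ereal_less_eq(3) leD order_trans)
  qed
  moreover have "banach_on (UNIV \<times> UNIV) M"
    unfolding UNIV_Times_UNIV
    using complete_UNIV_prod[OF complete_UNIV_bcontfun complete_UNIV] M(1,3)
    by (intro banach_on_equivalent_norm[OF banach_on_UNIV_complete])
  moreover have "M (x, 0) = norm x" for x using f(2)[of x] by (simp add: M_def)
  moreover have "wijsman_converges UNIV norm UNIV (\<le>) Cn {0}"
    using wijsman_tail_indicator by (simp add: Cn_def[abs_def])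
  ultimately show ?thesis
    using M(2) dir banach_on_ambient
    by (intro exI[of _ UNIV] exI[of _ norm] exI[of _ M] exI[of _ "(\<le>)"] exI[of _ Cn] exI[of _ "{0}"])
      (simp add: closed Cn_def)
qed

theorem proposition2p1:
  shows
    "(\<forall>(Y :: 'v::real_vector set) NY X NX (D :: 'i set) le Cn C.
        banach_on Y NY \<and> superspace X NX Y NY \<and> directed_set D le \<and>
        (\<forall>\<alpha>\<in>D. closed_convex_in Y NY (Cn \<alpha>)) \<and> closed_convex_in Y NY C \<longrightarrow>
        (slice_converges Y NY D le Cn C \<longrightarrow> slice_converges X NX D le Cn C) \<and>
        (mosco_converges Y NY D le Cn C \<longrightarrow> mosco_converges X NX D le Cn C))
     \<and>
     (\<exists>(X :: ambient set) N M (D :: nat set) le Cn C.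
        banach_on X N \<and>
        banach_on (X \<times> (UNIV :: real set)) M \<and>
        equivalent_norms (X \<times> (UNIV :: real set)) (product_norm N) M \<and>
        (\<forall>x\<in>X. M (x, 0) = N x) \<and>
        directed_set D le \<and>
        (\<forall>\<alpha>\<in>D. closed_convex_in X N (Cn \<alpha>)) \<and> closed_convex_in X N C \<and>
        wijsman_converges X N D le Cn C \<and>
        \<not> wijsman_converges (X \<times> (UNIV :: real set)) M D le (\<lambda>\<alpha>. Cn \<alpha> \<times> {0}) (C \<times> {0}))"
proof (intro conjI allI impI; (elim conjE)?)
  fix Y :: "'v set" and NY X NX and D :: "'i set" and le Cn C
  assume Y: "banach_on Y NY" and sup: "superspace X NX Y NY" and D: "directed_set D le"
    and Cn: "\<forall>\<alpha>\<in>D. closed_convex_in Y NY (Cn \<alpha>)" and C: "closed_convex_in Y NY C"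
  \<comment> \<open>Closedness in the norm topology of \<open>Y\<close> includes containment in its
    carrier.\<close>
  have sub: "A \<subseteq> Y" if "closed_convex_in Y NY A" for A
    using that Y by (simp add: closed_convex_in_def banach_on_def closedin_norm_topology)
  show "slice_converges X NX D le Cn C" if "slice_converges Y NY D le Cn C"
    using slice_converges_superspace[OF sup D _ _ that] sub Cn C by blast
  show "mosco_converges X NX D le Cn C" if "mosco_converges Y NY D le Cn C"
    using mosco_converges_superspace[OF sup D _ _ that] sub Cn C by blast
qed (rule wijsman_not_preserved)

end
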